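(* Let $0<q<1$, let $r$ be a positive integer, and let $m,n$ be either both non-negative integers or both positive half-integers. Then $$\sum_{k_1,\dots,k_r=-n}^n\ \prod_{1\le i<j\le r}[k_j-k_i]_q^2\,[k_i+k_j]_q^2\ \prod_{i=1}^r q^{k_i^2-(2i-\frac32)k_i}\,\frac{1+q^{k_i}}{1+q}\begin{bmatrix}2n\\ n+k_i\end{bmatrix}_q\begin{bmatrix}2m\\ m+k_i\end{bmatrix}_q$$ $$=r!\Big(\frac{2}{[2]_q}\Big)^r q^{-2\binom{r+1}{3}+\frac12\binom r2}\prod_{i=1}^r\Bigg(\frac{\Gamma_{q^{1/2}}(2i-1)\,\Gamma_q(2n+1)\,\Gamma_q(2m+1)}{\Gamma_q(m+n-i+2)\,\Gamma_q(m+n-i-r+3)}\cdot\frac{\Gamma_{q^{1/2}}(2m+2n-2i-2r+5)}{\Gamma_{q^{1/2}}(2n-2i+3)\,\Gamma_{q^{1/2}}(2m-2i+3)}\Bigg).$$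
   Context: Each $k_i$ runs over $\{-n,-n+1,\dots,n\}$ (half-integers, i.e. elements of $\frac12+\mathbb{Z}$, if $n$ is a half-integer). Notation: $(a;q)_\infty=\prod_{k\ge1}(1-aq^{k-1})$; $(a;q)_k=\prod_{j=1}^k(1-aq^{j-1})$; $\begin{bmatrix}N\\ M\end{bmatrix}_q=\frac{(q;q)_N}{(q;q)_M(q;q)_{N-M}}$ for integers $0\le M\le N$, and $0$ for integers $M<0$ or $M>N$; $[x]_q=\frac{1-q^x}{1-q}$; $\Gamma_q(x)=(1-q)^{1-x}\frac{(q;q)_\infty}{(q^x;q)_\infty}$, so $1/\Gamma_q(x)=0$ for $x\in\{0,-1,-2,\dots\}$. If a numerator factor on the right-hand side has a pole, the right-hand side is understood as its limiting value when $m,n$ are replaced by $m+\varepsilon,n+\varepsilon$ and $\varepsilon\to0$. *)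

theory Defs
  imports "HOL-Analysis.Analysis" "HOL-Library.Nonpos_Ints" "HOL-Library.FuncSet"
begin

definition qpoch_inf :: "real \<Rightarrow> real \<Rightarrow> real" where
  "qpoch_inf a q = (\<Prod>k. 1 - a * q ^ k)"

definition qpoch :: "real \<Rightarrow> real \<Rightarrow> nat \<Rightarrow> real" where
  "qpoch a q k = (\<Prod>j = 1..k. 1 - a * q ^ (j - 1))"

definition qbinomial :: "real \<Rightarrow> int \<Rightarrow> int \<Rightarrow> real" where
  "qbinomial q N M =
     (if 0 \<le> M \<and> M \<le> N
      then qpoch q q (nat N) / (qpoch q q (nat M) * qpoch q q (nat (N - M)))
      else 0)"

definition qbracket :: "real \<Rightarrow> real \<Rightarrow> real" where
  "qbracket q x = (1 - q powr x) / (1 - q)"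

text \<open>
  For \<open>0 < q < 1\<close> the poles of the q-Gamma function on the real line are the non-positive
  integers. There the definition below takes the junk value \<open>c / 0 = 0\<close>. As a divisor this is
  harmless, because \<open>a / 0 = 0\<close> agrees with the convention \<open>1 / \<Gamma>\<^sub>q(x) = 0\<close> at poles. Poles of
  numerator factors have to be treated separately, see \<open>rhs_numerator_pole\<close>.
\<close>

definition qGamma :: "real \<Rightarrow> real \<Rightarrow> real" where
  "qGamma q x = (1 - q) powr (1 - x) * qpoch_inf q q / qpoch_inf (q powr x) q"

definition half_integer :: "real \<Rightarrow> bool" where
  "half_integer x \<longleftrightarrow> x - 1 / 2 \<in> \<int>"

text \<open>The range \<open>-n, -n + 1, \<dots>, n\<close>, where \<open>2 * n\<close> is a non-negative integer.\<close>

definition sum_range :: "real \<Rightarrow> real set" where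
  "sum_range n = (\<lambda>j. - n + real j) ` {..nat \<lfloor>2 * n\<rfloor>}"

text \<open>
  The arguments of the q-binomial coefficients are integers, so that the floors only
  convert types.
\<close>

definition lhs_sum :: "real \<Rightarrow> nat \<Rightarrow> real \<Rightarrow> real \<Rightarrow> real" where
  "lhs_sum q r m n =
     (\<Sum>k \<in> {1..r} \<rightarrow>\<^sub>E sum_range n.
        (\<Prod>i = 1..r. \<Prod>j \<in> {i<..r}. (qbracket q (k j - k i))\<^sup>2 * (qbracket q (k i + k j))\<^sup>2) *
        (\<Prod>i = 1..r. q powr ((k i)\<^sup>2 - (2 * real i - 3 / 2) * k i)
           * ((1 + q powr k i) / (1 + q))
           * qbinomial q \<lfloor>2 * n\<rfloor> \<lfloor>n + k i\<rfloor>
           * qbinomial q \<lfloor>2 * m\<rfloor> \<lfloor>m + k i\<rfloor>))"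

definition rhs_product :: "real \<Rightarrow> nat \<Rightarrow> real \<Rightarrow> real \<Rightarrow> real" where
  "rhs_product q r m n =
     fact r * (2 / qbracket q 2) ^ r
     * q powr (- 2 * real ((r + 1) choose 3) + 1 / 2 * real (r choose 2))
     * (\<Prod>i = 1..r.
          (qGamma (q powr (1 / 2)) (2 * real i - 1)
             * qGamma q (2 * n + 1) * qGamma q (2 * m + 1))
          / (qGamma q (m + n - real i + 2) * qGamma q (m + n - real i - real r + 3))
          * (qGamma (q powr (1 / 2)) (2 * m + 2 * n - 2 * real i - 2 * real r + 5)
             / (qGamma (q powr (1 / 2)) (2 * n - 2 * real i + 3)
                * qGamma (q powr (1 / 2)) (2 * m - 2 * real i + 3))))"

text \<open>Some q-Gamma factor in a numerator of \<open>rhs_product q r m n\<close> has a pole.\<close>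

definition rhs_numerator_pole :: "nat \<Rightarrow> real \<Rightarrow> real \<Rightarrow> bool" where
  "rhs_numerator_pole r m n \<longleftrightarrow>
     (\<exists>i \<in> {1..r}. \<exists>x \<in> {2 * real i - 1, 2 * n + 1, 2 * m + 1,
                       2 * m + 2 * n - 2 * real i - 2 * real r + 5}. x \<in> \<int>\<^sub>\<le>\<^sub>0)"

end

theory Submission
  imports Defs "Jordan_Normal_Form.Determinant"
begin

text \<open>
  Put \<open>x\<^sub>k = q\<^sup>k + q\<^sup>-\<^sup>k\<close> and \<open>p = q\<^sup>1\<^sup>/\<^sup>2\<close>. Since
  \<open>(1 - q\<^sup>b\<^sup>-\<^sup>a) (1 - q\<^sup>a\<^sup>+\<^sup>b) = q\<^sup>b (x\<^sub>b - x\<^sub>a)\<close>, the squared brackets form the square of a Vandermonde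
  product in the \<open>x\<close>-variables, up to powers of \<open>1 - q\<close> and \<open>q\<close>. The powers of \<open>q\<close> cancel the
  dependence of the exponent on \<open>i\<close>, so that the left-hand side becomes a discrete Selberg sum:
  a squared Vandermonde product times a product of one and the same weight \<open>w(k\<^sub>i)\<close>.

  A Vandermonde product is the determinant of any Newton basis. One of the two copies is
  written in the basis with nodes \<open>x\<^sub>n, x\<^sub>n\<^sub>-\<^sub>1, \<dots>\<close> and the other in the basis with nodes
  \<open>x\<^sub>m, x\<^sub>m\<^sub>-\<^sub>1, \<dots>\<close>; the identity of Andreief (\<open>andreief\<close>) then turns the sum into \<open>r!\<close> times an
  \<open>r\<close> by \<open>r\<close> determinant of single sums. The Newton polynomials of these nodes lower the
  parameters of the two q-binomial coefficients, so the entry \<open>(i, j)\<close> is, up to q-factorials, the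
  case \<open>r = 1\<close> of the left-hand side with \<open>n, m\<close> replaced by \<open>n - i, m - j\<close> (\<open>lhs_sum_eq_det\<close>).

  That single sum is a terminating very-well-poised \<open>6\<phi>5\<close> series. A telescoping argument gives a
  first-order recurrence in \<open>n\<close> and hence a closed form (\<open>moment_eval\<close>): a function of \<open>n\<close> times
  the same function of \<open>m\<close> times \<open>H(n + m)\<close>, where \<open>H(M) = (p;q)\<^sub>M / (q;q)\<^sub>M\<close>. What remains is the
  Hankel-type determinant of \<open>H(m + n - i - j)\<close>. Clearing its first row by column operations
  leaves, up to factors attached to rows and columns, a determinant of the same family and
  of smaller size, which evaluates it (\<open>det_qpoch_quotient\<close>).

  If \<open>r - 1 \<le> n\<close> and \<open>r - 1 \<le> m\<close>, all arguments of q-Gamma functions on the right-hand side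
  are positive integers and the two sides are compared factor by factor. Otherwise the
  determinant has a zero row or a zero column and the left-hand side vanishes, while on the
  right-hand side \<open>\<Gamma>\<^sub>p(2n - 2r + 3)\<close> or \<open>\<Gamma>\<^sub>p(2m - 2r + 3)\<close> has a pole in the denominator. Poles of
  numerator factors cannot compensate for it: they occur only in \<open>\<Gamma>\<^sub>p(2y - 1)\<close> with
  \<open>y = m + n - i - r + 3\<close>, and by the duplication formula \<open>\<Gamma>\<^sub>p(2y - 1) / \<Gamma>\<^sub>q(y)\<close> stays bounded.
\<close>

section \<open>Andreief's identity and Newton bases\<close>

lemma det_mat_leibniz:
  "Determinant.det (mat n n f) = (\<Sum>p | p permutes {0..<n}. signof p * (\<Prod>i = 0..<n. f (i, p i)))"
  for f :: "nat \<times> nat \<Rightarrow> 'a :: comm_ring_1"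
proof -
  have "(\<Prod>i = 0..<n. mat n n f $$ (i, p i)) = (\<Prod>i = 0..<n. f (i, p i))"
    if "p permutes {0..<n}" for p
    using that permutes_in_image by (intro prod.cong) fastforce+
  then show ?thesis
    by (subst det_def'[of _ n]) (auto intro!: sum.cong)
qed

lemma PiE_compose_permutes:
  assumes "p permutes {0..<n}"
  shows "bij_betw (\<lambda>k. k \<circ> p) ({0..<n} \<rightarrow>\<^sub>E K) ({0..<n} \<rightarrow>\<^sub>E K)"
proof (rule bij_betw_byWitness[where f' = "\<lambda>k. k \<circ> Hilbert_Choice.inv p"])
  have *: "(\<lambda>k. k \<circ> s) ` ({0..<n} \<rightarrow>\<^sub>E K) \<subseteq> {0..<n} \<rightarrow>\<^sub>E K" if "s permutes {0..<n}" for s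
    using permutes_in_image[OF that] permutes_not_in[OF that]
    by (auto simp: PiE_iff extensional_def)
  show "(\<lambda>k. k \<circ> p) ` ({0..<n} \<rightarrow>\<^sub>E K) \<subseteq> {0..<n} \<rightarrow>\<^sub>E K"
    "(\<lambda>k. k \<circ> Hilbert_Choice.inv p) ` ({0..<n} \<rightarrow>\<^sub>E K) \<subseteq> {0..<n} \<rightarrow>\<^sub>E K"
    using *[OF assms] *[OF permutes_inv[OF assms]] by auto
qed (simp_all add: comp_assoc permutes_inv_o[OF assms])

text \<open>
  Expanding the first determinant gives \<open>r!\<close> equal contributions: renaming the summation
  variables by a permutation \<open>p\<close> costs the sign of \<open>p\<close> in the second determinant, which cancels
  the sign in the Leibniz formula. In the one contribution that is left, the sum over all
  families factors into single sums.
\<close>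

lemma andreief:
  fixes f g :: "nat \<Rightarrow> 'b \<Rightarrow> 'a :: comm_ring_1"
  assumes "finite K"
  shows "(\<Sum>k \<in> {0..<r} \<rightarrow>\<^sub>E K. Determinant.det (mat r r (\<lambda>(i, j). f i (k j)))
                              * Determinant.det (mat r r (\<lambda>(i, j). g i (k j))))
         = of_nat (fact r) * Determinant.det (mat r r (\<lambda>(i, j). \<Sum>x\<in>K. f i x * g j x))"
proof -
  let ?P = "{p. p permutes {0..<r}}"
  let ?X = "{0..<r} \<rightarrow>\<^sub>E K"
  let ?D = "\<lambda>k. Determinant.det (mat r r (\<lambda>(i, j). g i (k j)))"
  \<comment> \<open>the second determinant is alternating in the points\<close>
  have perm: "?D (k \<circ> p) = signof p * ?D k" if "p permutes {0..<r}" for k p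
  proof -
    have "Determinant.det (mat r r (\<lambda>(i, j). mat r r (\<lambda>(i, j). g j (k i)) $$ (p i, j)))
        = signof p * Determinant.det (mat r r (\<lambda>(i, j). g j (k i)))"
      by (rule det_permute_rows[OF _ that]) simp
    moreover have "mat r r (\<lambda>(i, j). mat r r (\<lambda>(i, j). g j (k i)) $$ (p i, j)) =
        (mat r r (\<lambda>(i, j). g i ((k \<circ> p) j)))\<^sup>T"
      using permutes_in_image[OF that] by (intro eq_matI) auto
    moreover have "mat r r (\<lambda>(i, j). g j (k i)) = (mat r r (\<lambda>(i, j). g i (k j)))\<^sup>T"
      by (intro eq_matI) auto
    ultimately show ?thesis
      using det_transpose[of "mat r r (\<lambda>(i, j). g i ((k \<circ> p) j))" r]
        det_transpose[of "mat r r (\<lambda>(i, j). g i (k j))" r] by simp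
  qed
  have reorder: "(\<Sum>k\<in>?X. signof p * (\<Prod>i = 0..<r. f i (k (p i))) * ?D k)
      = (\<Sum>k\<in>?X. (\<Prod>i = 0..<r. f i (k i)) * ?D k)" if p: "p permutes {0..<r}" for p
  proof -
    have "(\<Sum>k\<in>?X. (\<Prod>i = 0..<r. f i (k i)) * ?D k)
        = (\<Sum>k\<in>?X. (\<Prod>i = 0..<r. f i ((k \<circ> p) i)) * ?D (k \<circ> p))"
      by (rule sum.reindex_bij_betw[OF PiE_compose_permutes[OF p], symmetric])
    also have "\<dots> = (\<Sum>k\<in>?X. signof p * (\<Prod>i = 0..<r. f i (k (p i))) * ?D k)"
      by (intro sum.cong) (simp_all add: perm[OF p, unfolded comp_apply] mult_ac)
    finally show ?thesis by simp
  qed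
  have "(\<Sum>k\<in>?X. Determinant.det (mat r r (\<lambda>(i, j). f i (k j))) * ?D k)
      = (\<Sum>k\<in>?X. \<Sum>p\<in>?P. signof p * (\<Prod>i = 0..<r. f i (k (p i))) * ?D k)"
    by (simp add: det_mat_leibniz[of r "\<lambda>(i, j). f i (_ j)"] sum_distrib_right)
  also have "\<dots> = (\<Sum>p\<in>?P. \<Sum>k\<in>?X. (\<Prod>i = 0..<r. f i (k i)) * ?D k)"
    by (subst sum.swap) (rule sum.cong[OF refl], rule reorder, simp)
  also have "\<dots> = of_nat (fact r) * (\<Sum>k\<in>?X. (\<Prod>i = 0..<r. f i (k i)) * ?D k)"
    by (simp add: card_permutations[of _ r])
  also have "(\<Sum>k\<in>?X. (\<Prod>i = 0..<r. f i (k i)) * ?D k)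
     = (\<Sum>k\<in>?X. \<Sum>p\<in>?P. signof p * (\<Prod>i = 0..<r. f i (k i) * g (p i) (k i)))"
  proof (intro sum.cong refl)
    fix k assume "k \<in> ?X"
    have "?D k = Determinant.det (mat r r (\<lambda>(i, j). g j (k i)))"
    proof -
      have "mat r r (\<lambda>(i, j). g j (k i)) = (mat r r (\<lambda>(i, j). g i (k j)))\<^sup>T"
        by (intro eq_matI) auto
      then show ?thesis
        using det_transpose[of "mat r r (\<lambda>(i, j). g i (k j))" r] by simp
    qed
    then show "(\<Prod>i = 0..<r. f i (k i)) * ?D k
      = (\<Sum>p\<in>?P. signof p * (\<Prod>i = 0..<r. f i (k i) * g (p i) (k i)))"
      by (simp add: det_mat_leibniz sum_distrib_left prod.distrib mult_ac)
  qed
  also have "\<dots> = (\<Sum>p\<in>?P. signof p * (\<Prod>i = 0..<r. \<Sum>x\<in>K. f i x * g (p i) x))"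
    by (subst sum.swap)
      (intro sum.cong refl, subst prod_sum_PiE, use assms in \<open>auto simp: sum_distrib_left\<close>)
  finally show ?thesis
    by (simp add: det_mat_leibniz)
qed

text \<open>
  The transition matrix between two Newton bases is unitriangular and does not depend on \<open>x\<close>.
  The induction step splits the new factor as \<open>x - c\<^sub>i = (x - d\<^sub>l) + (d\<^sub>l - c\<^sub>i)\<close> in the \<open>l\<close>-th term.
\<close>

lemma newton_basis_change:
  fixes c d :: "nat \<Rightarrow> 'a :: comm_ring_1"
  shows "\<exists>t. t i = 1 \<and> (\<forall>l>i. t l = 0) \<and>
      (\<forall>x. (\<Prod>l<i. x - c l) = (\<Sum>l\<le>i. t l * (\<Prod>u<l. x - d u)))"
proof (induction i)
  case 0
  show ?case by (rule exI[of _ "\<lambda>l. if l = 0 then 1 else 0"]) auto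
next
  case (Suc i)
  then obtain t where t: "t i = 1" "\<And>l. l > i \<Longrightarrow> t l = 0"
    "\<And>x. (\<Prod>l<i. x - c l) = (\<Sum>l\<le>i. t l * (\<Prod>u<l. x - d u))" by blast
  define s where "s l = (case l of 0 \<Rightarrow> 0 | Suc k \<Rightarrow> t k) + t l * (d l - c i)" for l
  have "(\<Prod>l<Suc i. x - c l) = (\<Sum>l\<le>Suc i. s l * (\<Prod>u<l. x - d u))" for x
  proof -
    have "(\<Prod>l<Suc i. x - c l) = (\<Sum>l\<le>i. t l * (\<Prod>u<l. x - d u) * (x - c i))"
      by (simp add: t(3) sum_distrib_right)
    also have "\<dots> = (\<Sum>l\<le>i. t l * (\<Prod>u<Suc l. x - d u)) + (\<Sum>l\<le>i. t l * (d l - c i) * (\<Prod>u<l. x - d u))"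
      by (simp add: sum.distrib[symmetric] algebra_simps)
    also have "(\<Sum>l\<le>i. t l * (\<Prod>u<Suc l. x - d u))
        = (\<Sum>l\<le>Suc i. (case l of 0 \<Rightarrow> 0 | Suc k \<Rightarrow> t k) * (\<Prod>u<l. x - d u))"
      by (subst sum.atMost_Suc_shift) simp
    also have "(\<Sum>l\<le>i. t l * (d l - c i) * (\<Prod>u<l. x - d u))
        = (\<Sum>l\<le>Suc i. t l * (d l - c i) * (\<Prod>u<l. x - d u))"
      using t(2)[of "Suc i"] by simp
    finally show ?thesis
      by (simp only: s_def sum.distrib[symmetric] distrib_right)
  qed
  moreover have "s (Suc i) = 1" "\<forall>l>Suc i. s l = 0"
    using t by (auto simp: s_def split: nat.splits)
  ultimately show ?case by blast
qed

text \<open>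
  By \<open>newton_basis_change\<close> the nodes can be replaced without changing the determinant. With
  the points \<open>x\<close> themselves as nodes the matrix is triangular, and the Vandermonde product
  stands on its diagonal.
\<close>

lemma det_newton_basis:
  fixes c x :: "nat \<Rightarrow> 'a :: idom"
  shows "Determinant.det (mat r r (\<lambda>(i, j). \<Prod>l<i. x j - c l)) = (\<Prod>j<r. \<Prod>l<j. x j - x l)"
proof -
  have "\<forall>i. \<exists>t. t i = 1 \<and> (\<forall>l>i. t l = 0) \<and>
      (\<forall>y. (\<Prod>l<i. y - c l) = (\<Sum>l\<le>i. t l * (\<Prod>u<l. y - x u)))"
    using newton_basis_change by blast
  then obtain t where t: "\<And>i. t i i = 1" "\<And>i l. l > i \<Longrightarrow> t i l = 0"
    "\<And>i y. (\<Prod>l<i. y - c l) = (\<Sum>l\<le>i. t i l * (\<Prod>u<l. y - x u))" by metis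
  \<comment> \<open>basis change from the nodes \<open>c\<close> to the nodes \<open>x\<close>\<close>
  let ?T = "mat r r (\<lambda>(i, l). t i l)"
  let ?V = "mat r r (\<lambda>(l, j). \<Prod>u<l. x j - x u)"
  have "mat r r (\<lambda>(i, j). \<Prod>l<i. x j - c l) = ?T * ?V"
  proof (rule eq_matI)
    fix i j assume ij: "i < dim_row (?T * ?V)" "j < dim_col (?T * ?V)"
    have "(?T * ?V) $$ (i, j) = (\<Sum>l = 0..<r. t i l * (\<Prod>u<l. x j - x u))"
      using ij by (simp add: scalar_prod_def)
    also have "\<dots> = (\<Sum>l\<le>i. t i l * (\<Prod>u<l. x j - x u))"
      using ij by (intro sum.mono_neutral_right) (auto simp: t(2))
    finally show "mat r r (\<lambda>(i, j). \<Prod>l<i. x j - c l) $$ (i, j) = (?T * ?V) $$ (i, j)"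
      using ij t(3)[of "x j" i] by simp
  qed simp_all
  moreover have "Determinant.det ?T = 1"
    by (subst det_lower_triangular[of r]) (auto simp: t prod_list_diag_prod)
  moreover have "Determinant.det ?V = (\<Prod>j<r. \<Prod>l<j. x j - x l)"
  proof -
    have "upper_triangular ?V"
      by (auto simp: upper_triangular_def intro!: bexI prod_zero)
    then have "Determinant.det ?V = prod_list (diag_mat ?V)"
      by (rule det_upper_triangular[of _ r]) simp
    also have "\<dots> = (\<Prod>j = 0..<r. ?V $$ (j, j))"
      by (simp add: prod_list_diag_prod)
    finally show ?thesis by (simp add: atLeast0LessThan)
  qed
  ultimately show ?thesis
    using det_mult[of ?T r ?V] by simp
qed

section \<open>A Hankel-type determinant of quotients of q-factorials\<close>

lemma qpoch_0 [simp]: "qpoch a q 0 = 1"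
  by (simp add: qpoch_def)

lemma qpoch_Suc: "qpoch a q (Suc k) = qpoch a q k * (1 - a * q ^ k)"
  by (simp add: qpoch_def)

lemma qpoch_minus:
  assumes "i \<le> k"
  shows "qpoch a q k = qpoch a q (k - i) * (\<Prod>l<i. 1 - a * q ^ (k - l - 1))"
  using assms
proof (induction i)
  case (Suc i)
  then have "k - i = Suc (k - Suc i)" by simp
  then have "qpoch a q (k - i) = qpoch a q (k - Suc i) * (1 - a * q ^ (k - Suc i))"
    by (metis qpoch_Suc)
  with Suc show ?case by simp
qed simp

text \<open>
  Subtracting \<open>\<gamma> j\<close> times column \<open>j\<close> from column \<open>j + 1\<close>, for all \<open>j\<close> at once, is multiplication
  by a unitriangular matrix with two diagonals.
\<close>

lemma det_eliminate_first_row: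
  fixes a :: "nat \<Rightarrow> nat \<Rightarrow> 'a :: idom"
  assumes "\<And>j. j < r \<Longrightarrow> a 0 (Suc j) = \<gamma> j * a 0 j"
  shows "Determinant.det (mat (Suc r) (Suc r) (\<lambda>(i, j). a i j))
       = a 0 0 * Determinant.det (mat r r (\<lambda>(i, j). a (Suc i) (Suc j) - \<gamma> j * a (Suc i) j))"
proof -
  let ?A = "mat (Suc r) (Suc r) (\<lambda>(i, j). a i j)"
  \<comment> \<open>the matrix of the column operations, and the result in block form\<close>
  let ?E = "mat (Suc r) (Suc r) (\<lambda>(i, j). if i = j then 1 else if Suc i = j then - \<gamma> i else 0)"
  let ?C = "mat r r (\<lambda>(i, j). a (Suc i) (Suc j) - \<gamma> j * a (Suc i) j)"
  let ?B = "four_block_mat (mat 1 1 (\<lambda>_. a 0 0)) (0\<^sub>m 1 r) (mat r 1 (\<lambda>(i, j). a (Suc i) 0)) ?C"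
  have "?A * ?E = ?B"
  proof (rule eq_matI)
    fix i j assume "i < dim_row ?B" "j < dim_col ?B"
    then have ij: "i < Suc r" "j < Suc r" by simp_all
    have "(?A * ?E) $$ (i, j) = (\<Sum>l = 0..<Suc r. a i l * (if l = j then 1 else if Suc l = j then - \<gamma> l else 0))"
      using ij by (simp add: scalar_prod_def)
    also have "\<dots> = (case j of 0 \<Rightarrow> a i 0 | Suc j' \<Rightarrow> a i (Suc j') - \<gamma> j' * a i j')"
    proof (cases j)
      case 0
      then show ?thesis
        by (simp add: if_distrib cong: if_cong)
    next
      case (Suc j')
      have "(\<Sum>l = 0..<Suc r. a i l * (if l = j then 1 else if Suc l = j then - \<gamma> l else 0))
        = (\<Sum>l \<in> {j', Suc j'}. a i l * (if l = j then 1 else if Suc l = j then - \<gamma> l else 0))"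
        using ij Suc by (intro sum.mono_neutral_right) auto
      then show ?thesis using Suc by simp
    qed
    also have "\<dots> = ?B $$ (i, j)"
      using ij assms by (cases i; cases j) auto
    finally show "(?A * ?E) $$ (i, j) = ?B $$ (i, j)" .
  qed simp_all
  moreover have "Determinant.det ?E = 1"
    by (subst det_upper_triangular[of _ "Suc r"]) (auto simp: upper_triangular_def prod_list_diag_prod)
  moreover have "Determinant.det ?B = a 0 0 * Determinant.det ?C"
    by (subst det_four_block_mat_upper_right_zero[of _ 1 _ r]) (auto simp: det_single)
  ultimately show ?thesis
    using det_mult[of ?A "Suc r" ?E] by simp
qed

lemma det_scale_rows_cols:
  fixes u v :: "nat \<Rightarrow> 'a :: comm_ring_1"
  shows "Determinant.det (mat r r (\<lambda>(i, j). u i * v j * a i j))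
    = (\<Prod>i<r. u i) * (\<Prod>j<r. v j) * Determinant.det (mat r r (\<lambda>(i, j). a i j))"
proof -
  have "(\<Prod>i = 0..<r. v (p i)) = (\<Prod>i<r. v i)" if "p permutes {0..<r}" for p
    using prod.permute[OF that, of v] by (simp add: atLeast0LessThan comp_def)
  then show ?thesis
    by (simp add: det_mat_leibniz prod.distrib sum_distrib_left mult_ac atLeast0LessThan)
qed

text \<open>
  Two neighbouring entries of the first row differ by the factor \<open>\<gamma>\<^sub>j\<close> below, so
  \<open>det_eliminate_first_row\<close> applies. The entries left over factor into a part depending on \<open>i\<close>, a
  part depending on \<open>j\<close>, and an entry of the same family with \<open>A\<close> lowered by 2 and \<open>d\<close> raised by 1.
  For this reason the difference \<open>d\<close> of the two indices is kept general, although the case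
  that matters for the sum is \<open>d = 0\<close>.
\<close>

lemma det_qpoch_quotient:
  fixes c q :: real
  assumes q: "0 < q" "q < 1" and A: "2 * r \<le> A + 2" and c: "\<And>k. c * q ^ k \<noteq> 1"
  shows "Determinant.det (mat r r (\<lambda>(i, j). qpoch c q (A - i - j) / qpoch q q (A + d - i - j)))
    = q powr (real A * (real r * (real r - 1) / 2) - real r * (real r - 1) * (2 * real r - 1) / 3)
      * (\<Prod>t<r. qpoch c q (A + 1 - t - r) / qpoch q q (A + d - t) * qpoch q q t
                 * (\<Prod>u<t. c - q ^ (d + u + 1)))"
  using A
proof (induction r arbitrary: A d)
  case 0
  then show ?case using q by simp
next
  case (Suc r)
  have ne: "qpoch q q k \<noteq> 0" for k
  proof -
    have "q * q ^ l < 1" for l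
      using power_Suc_less_one[of q l] q by (cases l) auto
    then have "1 - q * q ^ l \<noteq> 0" for l by (smt (verit))
    then show ?thesis by (auto simp: qpoch_def)
  qed
  have q0: "q \<noteq> 0" using q by simp
  define a where "a i j = qpoch c q (A - i - j) / qpoch q q (A + d - i - j)" for i j
  define \<gamma> where "\<gamma> j = (1 - q ^ (A + d - j)) / (1 - c * q ^ (A - j - 1))" for j
  have A: "2 * r \<le> A" using Suc.prems by simp
  have step: "a i (Suc j) = (1 - q ^ (A + d - i - j)) / (1 - c * q ^ (A - i - j - 1)) * a i j"
    if "i + j < A" for i j
  proof -
    have "A - i - j = Suc (A - i - j - 1)" "A + d - i - j = Suc (A + d - i - j - 1)"
      using that by simp_all
    then have "qpoch c q (A - i - j) = qpoch c q (A - i - j - 1) * (1 - c * q ^ (A - i - j - 1))"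
      "qpoch q q (A + d - i - j) = qpoch q q (A + d - i - j - 1) * (1 - q ^ (A + d - i - j))"
      by (metis qpoch_Suc, metis qpoch_Suc power_Suc)
    then show ?thesis
      using c[of "A - i - j - 1"] ne[of "A + d - i - j"] by (simp add: a_def)
  qed
  have first: "a 0 (Suc j) = \<gamma> j * a 0 j" if "j < r" for j
    using step[of 0 j] that A by (simp add: \<gamma>_def)
  have elim: "Determinant.det (mat (Suc r) (Suc r) (\<lambda>(i, j). a i j))
       = a 0 0 * Determinant.det (mat r r (\<lambda>(i, j). a (Suc i) (Suc j) - \<gamma> j * a (Suc i) j))"
    by (intro det_eliminate_first_row first)
  have entry: "a (Suc i) (Suc j) - \<gamma> j * a (Suc i) j
    = ((1 - q ^ (i + 1)) / q ^ i) * (q ^ (A - 2 - j) * (c - q ^ (d + 1)) / (1 - c * q ^ (A - j - 1)))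
      * (qpoch c q (A - 2 - i - j) / qpoch q q (A - 2 + (d + 1) - i - j))"
    if ij: "i < r" "j < r" for i j
  proof -
    define e where "e = A - 2 - i - j"
    have Ae: "A = e + 2 + i + j" using ij A by (simp add: e_def)
    have 1: "qpoch c q (Suc e) = qpoch c q e * (1 - c * q ^ e)"
      and 2: "qpoch q q (Suc (e + d + 1)) = qpoch q q (e + d + 1) * (1 - q ^ (e + d + 2))"
      by (simp_all add: qpoch_Suc)
    have X: "1 - c * q ^ (e + i + 1) \<noteq> 0" using c[of "e + i + 1"] by simp
    have ne1: "qpoch q q (e + d + 1) \<noteq> 0" by (rule ne)
    have a1: "a (Suc i) (Suc j) = qpoch c q e / qpoch q q (e + d)"
      by (simp add: a_def Ae)
    have a2: "a (Suc i) j = qpoch c q e * (1 - c * q ^ e) / (qpoch q q (e + d) * (1 - q ^ (e + d + 1)))"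
      using qpoch_Suc[of c q e] qpoch_Suc[of q q "e + d"] by (simp add: a_def Ae)
    have nz: "qpoch q q (e + d) \<noteq> 0" "1 - q ^ (e + d + 1) \<noteq> 0"
      using ne[of "e + d"] ne[of "Suc (e + d)"] by (auto simp: qpoch_Suc)
    have g: "\<gamma> j = (1 - q ^ (e + d + i + 2)) / (1 - c * q ^ (e + i + 1))"
      by (simp add: \<gamma>_def Ae add_ac)
    have "a (Suc i) (Suc j) - \<gamma> j * a (Suc i) j
      = qpoch c q e * ((1 - q ^ (e + d + 1)) * (1 - c * q ^ (e + i + 1))
           - (1 - q ^ (e + d + i + 2)) * (1 - c * q ^ e))
        / ((1 - c * q ^ (e + i + 1)) * (qpoch q q (e + d) * (1 - q ^ (e + d + 1))))"
      unfolding a1 a2 g using nz X by (simp add: divide_simps) (simp add: algebra_simps)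
    also have "(1 - q ^ (e + d + 1)) * (1 - c * q ^ (e + i + 1)) - (1 - q ^ (e + d + i + 2)) * (1 - c * q ^ e)
        = (1 - q ^ (i + 1)) * q ^ e * (c - q ^ (d + 1))"
      by (simp add: algebra_simps power_add power2_eq_square)
    \<comment> \<open>the factor of the row is separated; the rest depends on \<open>i + e = A - 2 - j\<close>\<close>
    also have "(1 - q ^ (i + 1)) * q ^ e = ((1 - q ^ (i + 1)) / q ^ i) * q ^ (e + i)"
      using q by (simp add: power_add)
    finally have "a (Suc i) (Suc j) - \<gamma> j * a (Suc i) j
      = qpoch c q e * ((1 - q ^ (i + 1)) / q ^ i * q ^ (e + i) * (c - q ^ (d + 1)))
        / ((1 - c * q ^ (e + i + 1)) * qpoch q q (e + d + 1))"
      by (simp add: qpoch_Suc)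
    moreover have "A - 2 - j = e + i" "A - j - 1 = e + i + 1" "A - 2 - i - j = e"
      "A - 2 + (d + 1) - i - j = e + d + 1"
      by (simp_all add: Ae)
    moreover have "x * (u / v * w * y) / (z * t) = (u / v) * (w * y / z) * (x / t)"
      for x u v w y z t :: real by (simp add: mult_ac)
    ultimately show ?thesis by (simp only:)
  qed
  have m1: "mat r r (\<lambda>(i, j). a (Suc i) (Suc j) - \<gamma> j * a (Suc i) j)
    = mat r r (\<lambda>(i, j). ((1 - q ^ (i + 1)) / q ^ i)
         * (q ^ (A - 2 - j) * (c - q ^ (d + 1)) / (1 - c * q ^ (A - j - 1)))
         * (qpoch c q (A - 2 - i - j) / qpoch q q (A - 2 + (d + 1) - i - j)))"
    by (rule cong_mat) (simp_all add: entry)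
  let ?E = "\<lambda>A r. real A * (real r * (real r - 1) / 2) - real r * (real r - 1) * (2 * real r - 1) / 3"
  have rows: "(\<Prod>i<r. (1 - q ^ (i + 1)) / q ^ i) = qpoch q q r / (\<Prod>i<r. q ^ i)"
    by (simp add: qpoch_def prod_dividef prod.atLeast1_atMost_eq)
  have cols: "(\<Prod>j<r. q ^ (A - 2 - j) * (c - q ^ (d + 1)) / (1 - c * q ^ (A - j - 1)))
     = (\<Prod>j<r. q ^ (A - 2 - j)) * (c - q ^ (d + 1)) ^ r / (\<Prod>j<r. 1 - c * q ^ (A - j - 1))"
    by (simp add: prod_dividef prod.distrib)
  \<comment> \<open>the denominators from the columns shorten the top left entry\<close>
  have top: "qpoch c q A = qpoch c q (A - r) * (\<Prod>j<r. 1 - c * q ^ (A - j - 1))"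
    using A by (intro qpoch_minus) simp
  have nz: "(\<Prod>j<r. 1 - c * q ^ (A - j - 1)) \<noteq> 0" "(\<Prod>j<r. q ^ j) \<noteq> 0"
    using c q0 by auto
  have "(\<Prod>j<k. q ^ (A - 2 - j)) / (\<Prod>i<k. q ^ i) = q powr (real k * real A - real k * (real k + 1))"
    if "k \<le> r" for k using that
  proof (induction k)
    case (Suc k)
    have "q ^ (A - 2 - k) / q ^ k = q powr (real (A - 2 - k) - real k)"
      using q by (simp add: powr_diff powr_realpow)
    also have "real (A - 2 - k) = real A - 2 - real k"
      using Suc.prems A by simp
    finally have 1: "q ^ (A - 2 - k) / q ^ k = q powr (real A - 2 - real k - real k)" .
    have "(\<Prod>j<Suc k. q ^ (A - 2 - j)) / (\<Prod>i<Suc k. q ^ i)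
      = (\<Prod>j<k. q ^ (A - 2 - j)) / (\<Prod>i<k. q ^ i) * (q ^ (A - 2 - k) / q ^ k)"
      by simp
    also have "\<dots> = q powr (real k * real A - real k * (real k + 1) + (real A - 2 - real k - real k))"
      using Suc unfolding 1 by (simp add: powr_add)
    also have "real k * real A - real k * (real k + 1) + (real A - 2 - real k - real k)
        = real (Suc k) * real A - real (Suc k) * (real (Suc k) + 1)"
      by (simp add: algebra_simps)
    finally show ?case .
  qed (use q in simp)
  then have "(\<Prod>j<r. q ^ (A - 2 - j)) / (\<Prod>i<r. q ^ i) * q powr ?E (A - 2) r
     = q powr (real r * real A - real r * (real r + 1) + ?E (A - 2) r)"
    by (simp add: powr_add)
  also have "real r * real A - real r * (real r + 1) + ?E (A - 2) r = ?E A (Suc r)"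
  proof (cases "r = 0")
    case False
    then have "real (A - 2) = real A - 2" using A by simp
    then show ?thesis by (simp add: field_simps)
  qed simp
  finally have E: "(\<Prod>j<r. q ^ (A - 2 - j)) / (\<Prod>i<r. q ^ i) * q powr ?E (A - 2) r
     = q powr ?E A (Suc r)" .
  let ?F = "\<lambda>t. qpoch c q (A - t - r) / qpoch q q (A + d - t)"
  have P1: "(\<Prod>t<r. qpoch c q (A - 2 + 1 - t - r) / qpoch q q (A - 2 + (d + 1) - t) * qpoch q q t
                 * (\<Prod>u<t. c - q ^ (d + 1 + u + 1)))
      = (\<Prod>t<r. ?F (Suc t) * qpoch q q t * (\<Prod>u<t. c - q ^ (d + Suc u + 1)))"
  proof (rule prod.cong[OF refl])
    fix t assume "t \<in> {..<r}"
    then have "A - 2 + 1 - t - r = A - Suc t - r" "A - 2 + (d + 1) - t = A + d - Suc t"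
      using A by auto
    then show "qpoch c q (A - 2 + 1 - t - r) / qpoch q q (A - 2 + (d + 1) - t) * qpoch q q t
                 * (\<Prod>u<t. c - q ^ (d + 1 + u + 1))
      = ?F (Suc t) * qpoch q q t * (\<Prod>u<t. c - q ^ (d + Suc u + 1))" by simp
  qed
  have P2: "(\<Prod>t<r. ?F (Suc t) * qpoch q q t * (\<Prod>u<t. c - q ^ (d + Suc u + 1)))
      * (qpoch q q r * (c - q ^ (d + 1)) ^ r * ?F 0)
      = (\<Prod>t<Suc r. ?F t) * (\<Prod>t<Suc r. qpoch q q t) * (\<Prod>t<Suc r. \<Prod>u<t. c - q ^ (d + u + 1))"
  proof -
    have 1: "(\<Prod>t<Suc r. \<Prod>u<t. c - q ^ (d + u + 1))
        = (\<Prod>t<r. (c - q ^ (d + 1)) * (\<Prod>u<t. c - q ^ (d + Suc u + 1)))"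
      by (subst prod.lessThan_Suc_shift)
        (simp add: prod.lessThan_Suc_shift del: prod.lessThan_Suc power_Suc)
    have 2: "(\<Prod>t<Suc r. ?F t) = ?F 0 * (\<Prod>t<r. ?F (Suc t))"
      by (rule prod.lessThan_Suc_shift)
    show ?thesis
      unfolding 1 2 prod.lessThan_Suc[of "qpoch q q"] by (simp only: prod.distrib prod_constant card_lessThan mult_ac)
  qed
  have P: "(\<Prod>t<r. qpoch c q (A - 2 + 1 - t - r) / qpoch q q (A - 2 + (d + 1) - t) * qpoch q q t
                 * (\<Prod>u<t. c - q ^ (d + 1 + u + 1))) * (qpoch q q r * (c - q ^ (d + 1)) ^ r * ?F 0)
      = (\<Prod>t<Suc r. ?F t * qpoch q q t * (\<Prod>u<t. c - q ^ (d + u + 1)))"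
    unfolding P1 P2 by (simp only: prod.distrib)
  have IH: "Determinant.det (mat r r (\<lambda>(i, j). qpoch c q (A - 2 - i - j) / qpoch q q (A - 2 + (d + 1) - i - j)))
    = q powr ?E (A - 2) r
      * (\<Prod>t<r. qpoch c q (A - 2 + 1 - t - r) / qpoch q q (A - 2 + (d + 1) - t) * qpoch q q t
                 * (\<Prod>u<t. c - q ^ (d + 1 + u + 1)))"
    using A by (intro Suc.IH) simp
  have "Determinant.det (mat (Suc r) (Suc r) (\<lambda>(i, j). a i j))
     = ((\<Prod>j<r. q ^ (A - 2 - j)) / (\<Prod>i<r. q ^ i) * q powr ?E (A - 2) r)
       * ((\<Prod>t<r. qpoch c q (A - 2 + 1 - t - r) / qpoch q q (A - 2 + (d + 1) - t) * qpoch q q t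
                 * (\<Prod>u<t. c - q ^ (d + 1 + u + 1))) * (qpoch q q r * (c - q ^ (d + 1)) ^ r * ?F 0))"
  proof -
    have F: "?F 0 = a 0 0 / (\<Prod>j<r. 1 - c * q ^ (A - j - 1))"
      using nz by (simp add: a_def top)
    have alg: "f0 * (qr / pi * (pj * cr / N) * (e * x)) = (pj / pi * e) * (x * (qr * cr * (f0 / N)))"
      for f0 qr pi pj cr N e x :: real by simp
    show ?thesis
      unfolding elim m1 det_scale_rows_cols IH rows cols F by (rule alg)
  qed
  then show ?case
    unfolding E P by (simp add: a_def)
qed

section \<open>Reciprocal q-factorials and symmetric ranges\<close>

text \<open>
  The reciprocal \<open>1 / (q;q)\<^sub>x\<close> on the integers inside the reals, with the convention that it
  vanishes at negative \<open>x\<close>. The convention makes \<open>rqfact_minus_one\<close> valid at every integer and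
  removes all bounds on summation indices.
\<close>

definition rqfact :: "real \<Rightarrow> real \<Rightarrow> real" where
  "rqfact q x = (if x \<in> \<nat> then 1 / qpoch q q (nat \<lfloor>x\<rfloor>) else 0)"

lemma qpoch_pos:
  assumes "0 < q" "q < 1" "a < 1"
  shows "0 < qpoch a q k"
proof -
  have "a * q ^ l < 1" for l
  proof (cases "a \<le> 0")
    case True
    then have "a * q ^ l \<le> 0" using assms by (simp add: mult_nonpos_nonneg)
    then show ?thesis by simp
  next
    case False
    then have "a * q ^ l \<le> a * 1" using assms by (intro mult_left_mono) (simp_all add: power_le_one)
    then show ?thesis using assms by simp
  qed
  then show ?thesis by (simp add: qpoch_def prod_pos)
qed

lemma rqfact_of_nat [simp]: "rqfact q (real k) = 1 / qpoch q q k"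
  by (simp add: rqfact_def)

lemma rqfact_neg: "x < 0 \<Longrightarrow> rqfact q x = 0"
  by (auto simp: rqfact_def elim: Nats_cases)

lemma rqfact_minus_one:
  assumes "0 < q" "q < 1" "x \<in> \<int>"
  shows "rqfact q (x - 1) = (1 - q powr x) * rqfact q x"
proof -
  consider "x < 0" | "x = 0" | k where "x = real (Suc k)"
  proof -
    obtain j where j: "x = of_int j" using assms(3) by (elim Ints_cases)
    consider "j < 0" | "j = 0" | "j > 0" by linarith
    then show thesis
    proof cases
      case 3
      then have "x = real (Suc (nat (j - 1)))" using j by simp
      then show thesis using that(3) by blast
    qed (use j that in auto)
  qed
  then show ?thesis
  proof cases
    case 3
    have "q powr x = q * q ^ k"
      using assms(1) unfolding 3 by (subst powr_realpow) simp_all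
    moreover have "1 - q * q ^ k \<noteq> 0"
      using qpoch_pos[OF assms(1,2,2), of "Suc k"] by (auto simp: qpoch_Suc)
    moreover have "rqfact q x = 1 / qpoch q q (Suc k)"
      unfolding 3 by (rule rqfact_of_nat)
    moreover have "x - 1 = real k" using 3 by simp
    ultimately show ?thesis
      by (simp add: qpoch_Suc)
  qed (use assms in \<open>simp_all add: rqfact_neg\<close>)
qed

lemma sum_range_uminus:
  assumes "2 * n0 \<in> \<nat>"
  shows "bij_betw uminus (sum_range n0) (sum_range n0)"
proof (rule bij_betw_byWitness[where f' = uminus])
  obtain L where L: "2 * n0 = real L" using assms by (elim Nats_cases)
  then have n0: "n0 = real L / 2" by simp
  show "uminus ` sum_range n0 \<subseteq> sum_range n0"
  proof clarify
    fix k assume "k \<in> sum_range n0"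
    then obtain j where j: "k = - n0 + real j" "j \<le> L" by (auto simp: sum_range_def L)
    then have "- k = - n0 + real (L - j)" by (simp add: n0 of_nat_diff)
    then show "- k \<in> sum_range n0" by (auto simp: sum_range_def L)
  qed
  then show "uminus ` sum_range n0 \<subseteq> sum_range n0" .
qed auto

lemma sum_sum_range_telescope:
  fixes G :: "real \<Rightarrow> real"
  assumes "2 * n0 \<in> \<nat>"
  shows "(\<Sum>k\<in>sum_range n0. G (k + 1) - G k) = G (n0 + 1) - G (- n0)"
proof -
  obtain L where L: "2 * n0 = real L" using assms by (elim Nats_cases)
  have "(\<Sum>k\<in>sum_range n0. G (k + 1) - G k) = (\<Sum>j<Suc L. G (- n0 + real (Suc j)) - G (- n0 + real j))"
    by (simp add: sum_range_def L sum.reindex inj_on_def lessThan_Suc_atMost add_ac)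
  also have "\<dots> = G (- n0 + real (Suc L)) - G (- n0)"
    using sum_lessThan_telescope[of "\<lambda>j. G (- n0 + real j)" "Suc L"] by simp
  also have "- n0 + real (Suc L) = n0 + 1" using L by simp
  finally show ?thesis .
qed

lemma Ints_sum_range:
  assumes "n + n0 \<in> \<int>" "2 * n0 \<in> \<nat>" "k \<in> sum_range n0"
  shows "n + k \<in> \<int>" "n - k \<in> \<int>"
proof -
  obtain j where j: "k = - n0 + real j" using assms(3) by (auto simp: sum_range_def)
  obtain L where L: "2 * n0 = real L" using assms(2) by (elim Nats_cases)
  have "n + n0 - real L + real j \<in> \<int>" "n + n0 - real j \<in> \<int>"
    by (rule Ints_add[OF Ints_diff[OF assms(1) Ints_of_nat] Ints_of_nat],
        rule Ints_diff[OF assms(1) Ints_of_nat])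
  moreover have "n + n0 - real L + real j = n + k" "n + n0 - real j = n - k"
    using L by (simp_all add: j)
  ultimately show "n + k \<in> \<int>" "n - k \<in> \<int>" by simp_all
qed

section \<open>The single sum\<close>

definition moment_kernel :: "real \<Rightarrow> real \<Rightarrow> real \<Rightarrow> real \<Rightarrow> real" where
  "moment_kernel q n m k =
     q powr (k\<^sup>2) * (rqfact q (n + k) * rqfact q (n - k) * rqfact q (m + k) * rqfact q (m - k))"

text \<open>
  The sums below run over the fixed range of \<open>n0\<close> while \<open>n\<close> and \<open>m\<close> vary; for \<open>n \<le> n0\<close> the range
  contains the whole support of the kernel. The sum with \<open>r = 1\<close> is the moment of order
  \<open>1/2\<close> times a factor made of q-factorials.
\<close>

definition moment :: "real \<Rightarrow> real \<Rightarrow> real \<Rightarrow> real \<Rightarrow> real \<Rightarrow> real" where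
  "moment q n0 n m s = (\<Sum>k\<in>sum_range n0. moment_kernel q n m k * q powr (s * k))"

lemma moment_uminus:
  assumes "2 * n0 \<in> \<nat>"
  shows "moment q n0 n m (- s) = moment q n0 n m s"
  unfolding moment_def
  by (subst sum.reindex_bij_betw[OF sum_range_uminus[OF assms], symmetric])
    (simp add: moment_kernel_def mult_ac)

text \<open>
  The differences of the auxiliary function \<open>G\<close> sum to zero, because \<open>G\<close> vanishes at both ends
  of the range. Expanded in powers of \<open>q\<^sup>k\<close> this is a linear relation between moments of orders
  \<open>1/2\<close>, \<open>-1/2\<close> and \<open>-3/2\<close>; by symmetry only two of them are distinct, so the moment of order \<open>3/2\<close>
  is a multiple of that of order \<open>1/2\<close>. Lowering \<open>n\<close> by one multiplies the kernel by
  \<open>(1 - q\<^sup>n\<^sup>+\<^sup>k) (1 - q\<^sup>n\<^sup>-\<^sup>k)\<close>, which involves the same two moments.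
\<close>

lemma moment_step:
  assumes q: "0 < q" "q < 1" and n0: "2 * n0 \<in> \<nat>" "n + n0 \<in> \<int>" "m + n0 \<in> \<int>" "n \<le> n0"
  shows "moment q n0 (n - 1) m (1/2) * (1 - q powr (n + m - 1/2))
    = moment q n0 n m (1/2) * (1 - q powr (n + m)) * (1 - q powr n) * (1 - q powr (n - 1/2))"
proof -
  let ?K = "sum_range n0"
  let ?M = "moment q n0 n m"
  define a b p where "a = q powr n" and "b = q powr m" and "p = q powr (1/2)"
  have pos: "a > 0" "b > 0" "p > 0" using q by (simp_all add: a_def b_def p_def)
  \<comment> \<open>\<open>G k\<close> and \<open>p * G (k + 1)\<close> are the kernel times the same three powers of \<open>q\<^sup>k\<close>, with the coefficients in opposite order\<close>
  define G where "G k = q powr (k\<^sup>2 - 3/2 * k) * (rqfact q (n + k - 1) * rqfact q (n - k)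
    * rqfact q (m + k - 1) * rqfact q (m - k))" for k
  have Gk: "G k = moment_kernel q n m k * q powr (- (3/2) * k)
      - (a + b) * (moment_kernel q n m k * q powr (- (1/2) * k))
      + a * b * (moment_kernel q n m k * q powr (1/2 * k))" (is ?thesis1)
    and Gk1: "p * G (k + 1) = moment_kernel q n m k * q powr (1/2 * k)
      - (a + b) * (moment_kernel q n m k * q powr (- (1/2) * k))
      + a * b * (moment_kernel q n m k * q powr (- (3/2) * k))" (is ?thesis2)
    and tk: "moment_kernel q (n - 1) m k * q powr (1/2 * k)
      = (1 + a\<^sup>2) * (moment_kernel q n m k * q powr (1/2 * k))
        - a * (moment_kernel q n m k * q powr (3/2 * k))
        - a * (moment_kernel q n m k * q powr (- (1/2) * k))" (is ?thesis3)
    if k: "k \<in> ?K" for k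
  proof -
    note I = Ints_sum_range[OF n0(2,1) k] Ints_sum_range[OF n0(3,1) k]
    define z where "z = q powr (1/2 * k)"
    define T where "T = rqfact q (n + k) * rqfact q (n - k) * rqfact q (m + k) * rqfact q (m - k)"
    have z: "z > 0" using q by (simp add: z_def)
    have zs: "q powr k = z\<^sup>2" "q powr (- (1/2) * k) = 1 / z" "q powr (- (3/2) * k) = 1 / z ^ 3"
      "q powr (3/2 * k) = z ^ 3"
      using q by (simp_all add: z_def powr_minus_divide powr_power)
    have ab: "q powr (n + k) = a * z\<^sup>2" "q powr (n - k) = a / z\<^sup>2"
       "q powr (m + k) = b * z\<^sup>2" "q powr (m - k) = b / z\<^sup>2"
      by (simp_all add: a_def b_def powr_add powr_diff flip: zs(1))
    have r: "rqfact q (n + k - 1) = (1 - a * z\<^sup>2) * rqfact q (n + k)"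
      "rqfact q (n - k - 1) = (1 - a / z\<^sup>2) * rqfact q (n - k)"
      "rqfact q (m + k - 1) = (1 - b * z\<^sup>2) * rqfact q (m + k)"
      "rqfact q (m - k - 1) = (1 - b / z\<^sup>2) * rqfact q (m - k)"
      using I q by (simp_all only: rqfact_minus_one ab)
    have K: "moment_kernel q n m k = q powr (k\<^sup>2) * T"
      by (simp add: moment_kernel_def T_def)
    have *: "G k = q powr (k\<^sup>2) * q powr (- (3/2) * k) * ((1 - a * z\<^sup>2) * (1 - b * z\<^sup>2) * T)"
      unfolding G_def r T_def by (simp add: powr_add[symmetric])
    show ?thesis1
      using z unfolding * zs K z_def[symmetric] by (simp add: field_simps power2_eq_square power3_eq_cube)
    have "p * G (k + 1) = p * q powr ((k + 1)\<^sup>2 - 3/2 * (k + 1)) * ((1 - a / z\<^sup>2) * (1 - b / z\<^sup>2) * T)"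
    proof -
      have e: "n + (k + 1) - 1 = n + k" "m + (k + 1) - 1 = m + k" "n - (k + 1) = n - k - 1"
        "m - (k + 1) = m - k - 1" by simp_all
      show ?thesis unfolding G_def e r T_def by simp
    qed
    also have "p * q powr ((k + 1)\<^sup>2 - 3/2 * (k + 1)) = q powr (k\<^sup>2) * z"
      unfolding p_def z_def powr_add[symmetric] by (simp add: power2_eq_square field_simps)
    finally have *: "p * G (k + 1) = q powr (k\<^sup>2) * z * ((1 - a / z\<^sup>2) * (1 - b / z\<^sup>2) * T)" .
    show ?thesis2
      using z unfolding * zs K z_def[symmetric] by (simp add: field_simps power2_eq_square power3_eq_cube)
    have *: "moment_kernel q (n - 1) m k = q powr (k\<^sup>2) * ((1 - a * z\<^sup>2) * (1 - a / z\<^sup>2) * T)"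
    proof -
      have e: "n - 1 + k = n + k - 1" "n - 1 - k = n - k - 1" by simp_all
      show ?thesis unfolding moment_kernel_def e r T_def by simp
    qed
    show ?thesis3
      using z unfolding * zs K z_def[symmetric] by (simp add: field_simps power2_eq_square power3_eq_cube)
  qed
  define A B where "A = ?M (1/2)" and "B = ?M (3/2)"
  have AB: "?M (- (1/2)) = A" "?M (- (3/2)) = B"
    unfolding A_def B_def by (simp_all only: moment_uminus[OF n0(1)])
  have "(\<Sum>k\<in>?K. G (k + 1)) - (\<Sum>k\<in>?K. G k) = G (n0 + 1) - G (- n0)"
    by (simp only: sum_sum_range_telescope[OF n0(1)] sum_subtractf[symmetric])
  also have "\<dots> = 0"
    using n0(4) by (simp add: G_def rqfact_neg)
  finally have "p * (\<Sum>k\<in>?K. G k) = (\<Sum>k\<in>?K. p * G (k + 1))"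
    by (simp add: sum_distrib_left[symmetric])
  moreover have "(\<Sum>k\<in>?K. G k) = B - (a + b) * A + a * b * A"
    by (subst sum.cong[OF refl Gk], assumption) (simp only: sum.distrib sum_subtractf sum_distrib_left[symmetric] moment_def[symmetric] AB A_def[symmetric])
  moreover have "(\<Sum>k\<in>?K. p * G (k + 1)) = A - (a + b) * A + a * b * B"
    by (subst sum.cong[OF refl Gk1], assumption) (simp only: sum.distrib sum_subtractf sum_distrib_left[symmetric] moment_def[symmetric] AB A_def[symmetric])
  \<comment> \<open>the moment of order \<open>3/2\<close> in terms of that of order \<open>1/2\<close>\<close>
  ultimately have B: "B * (p - a * b) = A * (p * (a + b) - p * a * b + 1 - a - b)"
    by (simp add: algebra_simps)
  have A': "moment q n0 (n - 1) m (1/2) = (1 + a\<^sup>2) * A - a * B - a * A"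
  proof -
    have "moment q n0 (n - 1) m (1/2) = (\<Sum>k\<in>?K. moment_kernel q (n - 1) m k * q powr (1/2 * k))"
      by (simp add: moment_def)
    also have "\<dots> = (1 + a\<^sup>2) * A - a * B - a * A"
      by (subst sum.cong[OF refl tk], assumption) (simp only: sum.distrib sum_subtractf sum_distrib_left[symmetric] moment_def[symmetric] AB A_def[symmetric] B_def[symmetric])
    finally show ?thesis .
  qed
  have "(p - a * b) * ((1 + a\<^sup>2) * A - a * B - a * A)
     = (p - a * b) * (1 + a\<^sup>2 - a) * A - a * (B * (p - a * b))"
    by (simp add: algebra_simps)
  also have "\<dots> = A * (1 - a * b) * (1 - a) * (p - a)"
    unfolding B by (simp add: algebra_simps power2_eq_square)
  finally have "((1 + a\<^sup>2) * A - a * B - a * A) * (1 - a * b / p) = A * (1 - a * b) * (1 - a) * (1 - a / p)"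
    using pos by (simp add: field_simps)
  moreover have "q powr (n + m - 1/2) = a * b / p" "q powr (n + m) = a * b" "q powr (n - 1/2) = a / p"
    by (simp_all add: a_def b_def p_def powr_add powr_diff)
  ultimately show ?thesis
    unfolding A' by (simp add: A_def a_def)
qed


text \<open>
  The even-indexed and the odd-indexed factors of \<open>(p;p)\<^sub>2\<^sub>k\<close> are separated.
\<close>

lemma qpoch_sqrt_double:
  assumes "p\<^sup>2 = q"
  shows "qpoch p p (2 * k) = qpoch p q k * qpoch q q k"
proof (induction k)
  case (Suc k)
  have "qpoch p p (2 * Suc k) = qpoch p p (2 * k) * (1 - p * p ^ (2 * k)) * (1 - p * p ^ (2 * k + 1))"
    by (simp add: qpoch_Suc)
  also have "p * p ^ (2 * k) = p * q ^ k"
    using assms by (simp add: power_mult)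
  also have "p * p ^ (2 * k + 1) = q * q ^ k"
    using assms by (simp add: power_mult power2_eq_square flip: assms)
  finally show ?case
    using Suc by (simp add: qpoch_Suc)
qed simp

lemma nat_floor_eqI: "x = real k \<Longrightarrow> nat \<lfloor>x\<rfloor> = k"
  by simp

text \<open>
  For these two values of \<open>n\<close> only the terms \<open>k = \<plusminus>n\<close> survive.
\<close>

lemma moment_base:
  assumes q: "0 < q" "q < 1" and n0: "2 * n0 \<in> \<nat>" "n + n0 \<in> \<int>" "m + n0 \<in> \<int>" "n \<le> n0"
    and n: "n = 0 \<or> n = 1/2" and m: "m \<ge> 0"
  defines "p \<equiv> q powr (1/2)"
  shows "moment q n0 n m (1/2) * (qpoch q q (nat \<lfloor>n + m\<rfloor>) * qpoch p p (nat \<lfloor>2 * n\<rfloor>) * qpoch p p (nat \<lfloor>2 * m\<rfloor>))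
    = qpoch p q (nat \<lfloor>n + m\<rfloor>)"
proof -
  obtain L where L: "2 * n0 = real L" using n0(1) by (elim Nats_cases)
  have p: "p\<^sup>2 = q" "0 < p" "p < 1"
    using q by (auto simp: p_def powr_power powr_half_sqrt)
  have pos: "qpoch q q k > 0" "qpoch p q k > 0" "qpoch p p k > 0" for k
    using q p by (simp_all add: qpoch_pos)
  have "m - n \<in> \<int>"
  proof -
    have "m + n0 - (n + n0) \<in> \<int>" by (rule Ints_diff[OF n0(3,2)])
    then show ?thesis by simp
  qed
  then obtain j where j: "m - n = of_int j" by (elim Ints_cases)
  have "j \<ge> 0" using j n m by auto
  then have mn: "m = n + real (nat j)" using j by simp
  \<comment> \<open>\<open>n + k\<close> and \<open>n - k\<close> are naturals with sum \<open>2 n \<le> 1\<close>, so one of them is zero\<close>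
  have supp: "k = n \<or> k = - n" if k: "k \<in> sum_range n0" and nz: "moment_kernel q n m k \<noteq> 0" for k
  proof -
    from nz have "n + k \<in> \<nat>" "n - k \<in> \<nat>"
      by (auto simp: moment_kernel_def rqfact_def split: if_splits)
    then obtain a b where "n + k = real a" "n - k = real b" by (auto elim!: Nats_cases)
    moreover from this have "real (a + b) = 2 * n" by simp
    then have "a + b \<le> 1" using n by auto
    then have "a = 0 \<or> b = 0" by auto
    ultimately show ?thesis by auto
  qed
  have mem: "{n, - n} \<subseteq> sum_range n0"
  proof -
    obtain i where i: "n + n0 = of_int i" using n0(2) by (elim Ints_cases)
    have "i \<ge> 0" "real_of_int i \<le> real L" using i n0(4) n L by auto
    then have "n \<in> sum_range n0"
      by (auto simp: sum_range_def L image_iff intro!: bexI[of _ "nat i"] simp flip: i) (use i in linarith)+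
    then show ?thesis
      using sum_range_uminus[OF n0(1)] by (auto simp: bij_betw_def)
  qed
  have M0: "moment q n0 n m (1/2) = (\<Sum>k\<in>{n, - n}. moment_kernel q n m k * q powr (1/2 * k))"
    unfolding moment_def using supp by (intro sum.mono_neutral_right mem) (auto simp: sum_range_def)
  have M: "moment q n0 n m (1/2) = (\<Sum>k\<in>{n, - n}. q powr (k\<^sup>2) * (rqfact q (n + k) * rqfact q (n - k)
      * rqfact q (m + k) * rqfact q (m - k)) * q powr (1/2 * k))"
    unfolding M0 moment_kernel_def ..
  from n show ?thesis
  proof (elim disjE)
    assume n0: "n = 0"
    define M' where "M' = nat j"
    have m: "m = real M'" "2 * m = real (2 * M')" using mn n0 by (simp_all add: M'_def)
    have "moment q n0 n m (1/2) = 1 / (qpoch q q M')\<^sup>2"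
      unfolding M unfolding n0 m using rqfact_of_nat[of q 0] q by (simp add: power2_eq_square)
    moreover have "nat \<lfloor>n + m\<rfloor> = M'" "nat \<lfloor>2 * n\<rfloor> = 0" "nat \<lfloor>2 * m\<rfloor> = 2 * M'"
      using n0 m by (simp_all add: nat_floor_eqI)
    ultimately show ?thesis
      using pos(1)[of M'] pos(2)[of M'] by (simp add: qpoch_sqrt_double[OF p(1)] power2_eq_square)
  next
    assume n2: "n = 1/2"
    define M' where "M' = nat j"
    have m: "m = real M' + 1/2" "2 * m = real (2 * M' + 1)" "n + m = real (Suc M')"
      "m + 1/2 = real (Suc M')" "m - 1/2 = real M'" "1/2 + 1/2 = real (Suc 0)"
      using mn n2 by (simp_all add: M'_def)
    have "moment q n0 n m (1/2) = (1 + p) / ((1 - q) * qpoch q q (Suc M') * qpoch q q M')"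
    proof -
      have "moment q n0 n m (1/2) = (q powr (1/4) * q powr (1/4) + q powr (1/4) * q powr (-1/4))
        * (rqfact q (1/2 + 1/2) * rqfact q (m + 1/2) * rqfact q (m - 1/2))"
        unfolding M unfolding n2 using rqfact_of_nat[of q 0] by (simp add: power2_eq_square algebra_simps)
      also have "q powr (1/4) * q powr (1/4) + q powr (1/4) * q powr (-1/4) = 1 + p"
        unfolding p_def powr_add[symmetric] using q by simp
      also have "rqfact q (1/2 + 1/2) * rqfact q (m + 1/2) * rqfact q (m - 1/2)
        = 1 / ((1 - q) * qpoch q q (Suc M') * qpoch q q M')"
        unfolding m(4-6) rqfact_of_nat by (simp add: qpoch_Suc)
      finally show ?thesis by simp
    qed
    moreover have "nat \<lfloor>n + m\<rfloor> = Suc M'" "nat \<lfloor>2 * n\<rfloor> = 1" "nat \<lfloor>2 * m\<rfloor> = 2 * M' + 1"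
      by (rule nat_floor_eqI[OF m(3)], simp add: n2, rule nat_floor_eqI[OF m(2)])
    moreover have "qpoch p p (2 * M' + 1) = qpoch p q (Suc M') * qpoch q q M'"
    proof -
      have Q: "q ^ Suc M' = p * p ^ (2 * M' + 1)"
        unfolding p(1)[symmetric] power_mult[symmetric] by simp
      have "qpoch p p (2 * M' + 1) * (1 - q ^ Suc M') = qpoch p p (2 * Suc M')"
        unfolding Q by (simp add: qpoch_Suc)
      also have "\<dots> = qpoch p q (Suc M') * qpoch q q M' * (1 - q ^ Suc M')"
        unfolding qpoch_sqrt_double[OF p(1)] by (simp add: qpoch_Suc[of q])
      finally show ?thesis
        using q power_Suc_less_one[of q M'] by (simp del: power_Suc)
    qed
    moreover have "qpoch p p 1 = 1 - p" by (simp add: qpoch_Suc[of _ _ 0, simplified])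
    moreover have "1 - q = (1 + p) * (1 - p)" using p(1) by (simp add: power2_eq_square algebra_simps)
    moreover have "1 + p \<noteq> 0" "1 - p \<noteq> 0" using p by simp_all
    ultimately show ?thesis
      using pos(1)[of M'] pos(1)[of "Suc M'"] by simp
  qed
qed

text \<open>
  Both sides satisfy the recurrence \<open>moment_step\<close>, which reduces \<open>n\<close> to its fractional part.
\<close>

lemma moment_eval:
  assumes q: "0 < q" "q < 1" and n0: "2 * n0 \<in> \<nat>" "n + n0 \<in> \<int>" "m + n0 \<in> \<int>" "n \<le> n0"
    and n: "n \<ge> 0" and m: "m \<ge> 0"
  defines "p \<equiv> q powr (1/2)"
  shows "moment q n0 n m (1/2) * (qpoch q q (nat \<lfloor>n + m\<rfloor>) * qpoch p p (nat \<lfloor>2 * n\<rfloor>) * qpoch p p (nat \<lfloor>2 * m\<rfloor>))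
    = qpoch p q (nat \<lfloor>n + m\<rfloor>)"
proof -
  have p: "p\<^sup>2 = q" "0 < p" "p < 1"
    using q by (auto simp: p_def powr_power powr_half_sqrt)
  obtain L where L: "2 * n0 = real L" using n0(1) by (elim Nats_cases)
  obtain a where a: "n + n0 = of_int a" using n0(2) by (elim Ints_cases)
  obtain b where b: "m + n0 = of_int b" using n0(3) by (elim Ints_cases)
  \<comment> \<open>the induction runs over the integer part \<open>i\<close> of \<open>n\<close>\<close>
  define i where "i = nat \<lfloor>n\<rfloor>"
  define \<nu> where "\<nu> = n - real i"
  have \<nu>: "\<nu> \<ge> 0" "\<nu> < 1" using n by (simp_all add: \<nu>_def i_def) linarith+
  have "2 * \<nu> = of_int (2 * a - int L - 2 * int i)"
    using a L by (simp add: \<nu>_def)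
  moreover from this \<nu> have "2 * a - int L - 2 * int i \<in> {0, 1}"
    by auto
  ultimately have \<nu>': "\<nu> = 0 \<or> \<nu> = 1/2" by auto
  then have "2 * \<nu> = real 0 \<or> 2 * \<nu> = real 1" by auto
  then obtain e where e: "2 * \<nu> = real e" by blast
  have "\<nu> + m = of_int (a + b - int L - int i)" using a b L by (simp add: \<nu>_def)
  moreover from this have "a + b - int L - int i \<ge> 0"
    using \<nu>(1) m by linarith
  ultimately obtain s where s: "\<nu> + m = real s" by (metis of_int_of_nat_eq zero_le_imp_eq_int)
  have "moment q n0 (\<nu> + real k) m (1/2)
       * (qpoch q q (s + k) * qpoch p p (e + 2 * k) * qpoch p p (nat \<lfloor>2 * m\<rfloor>)) = qpoch p q (s + k)"
    if "\<nu> + real k \<le> n0" for k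
    using that
  proof (induction k)
    case 0
    have "\<nu> + n0 \<in> \<int>"
      using Ints_diff[OF n0(2) Ints_of_nat[of i]] by (simp add: \<nu>_def algebra_simps)
    then show ?case
      using moment_base[OF q n0(1) _ n0(3) _ \<nu>' m] 0 by (simp add: s e p_def)
  next
    case (Suc k)
    let ?n = "\<nu> + real (Suc k)"
    have "\<nu> + n0 \<in> \<int>"
      using Ints_diff[OF n0(2) Ints_of_nat[of i]] by (simp add: \<nu>_def algebra_simps)
    then have "?n + n0 \<in> \<int>"
      using Ints_add[OF _ Ints_of_nat[of "Suc k"], of "\<nu> + n0"] by (simp add: algebra_simps)
    note step = moment_step[OF q n0(1) this n0(3) Suc.prems]
    have half: "q powr (real l / 2) = p ^ l" for l
      using q by (simp add: p_def powr_power field_simps)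
    have 1: "q powr (?n + m - 1/2) = p * q ^ (s + k)"
    proof -
      have "?n + m - 1/2 = real (2 * (s + k) + 1) / 2" using s by simp
      then have "q powr (?n + m - 1/2) = p ^ (2 * (s + k) + 1)" by (simp only: half)
      also have "\<dots> = p * (p\<^sup>2) ^ (s + k)" unfolding power_mult[symmetric] by simp
      finally show ?thesis by (simp only: p(1))
    qed
    have 2: "q powr (?n + m) = q * q ^ (s + k)"
    proof -
      have "?n + m = real (2 * (s + k + 1)) / 2" using s by simp
      then show ?thesis by (simp only: half power_mult p(1)) simp
    qed
    have 3: "q powr ?n = p * p ^ (e + 2 * k + 1)"
    proof -
      have "?n = real (e + 2 * k + 2) / 2" using e by simp
      then show ?thesis by (simp only: half) simp
    qed
    have 4: "q powr (?n - 1/2) = p * p ^ (e + 2 * k)"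
    proof -
      have "?n - 1/2 = real (e + 2 * k + 1) / 2" using e by simp
      then show ?thesis by (simp only: half) simp
    qed
    let ?C = "qpoch p p (nat \<lfloor>2 * m\<rfloor>)"
    have IH: "moment q n0 (?n - 1) m (1/2)
       * (qpoch q q (s + k) * qpoch p p (e + 2 * k) * ?C) = qpoch p q (s + k)"
      using Suc by simp
    have "moment q n0 ?n m (1/2) * (qpoch q q (s + Suc k) * qpoch p p (e + 2 * Suc k) * ?C)
      = (moment q n0 ?n m (1/2) * (1 - q * q ^ (s + k)) * (1 - p * p ^ (e + 2 * k + 1)) * (1 - p * p ^ (e + 2 * k)))
         * (qpoch q q (s + k) * qpoch p p (e + 2 * k) * ?C)"
      by (simp add: qpoch_Suc mult_ac)
    also have "\<dots> = moment q n0 (?n - 1) m (1/2) * (1 - p * q ^ (s + k)) * (qpoch q q (s + k) * qpoch p p (e + 2 * k) * ?C)"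
      using step unfolding 1 2 3 4 by simp
    also have "\<dots> = (moment q n0 (?n - 1) m (1/2) * (qpoch q q (s + k) * qpoch p p (e + 2 * k) * ?C)) * (1 - p * q ^ (s + k))"
      by (simp only: mult_ac)
    also have "\<dots> = qpoch p q (s + Suc k)"
      unfolding IH by (simp add: qpoch_Suc)
    finally show ?case .
  qed
  moreover have "n = \<nu> + real i" "n + m = real (s + i)" "2 * n = real (e + 2 * i)"
    using s e by (simp_all add: \<nu>_def)
  ultimately show ?thesis
    using n0(4) by (simp only: floor_of_nat nat_int)
qed

section \<open>The multiple sum as a determinant\<close>

text \<open>
  The variable in which the squared brackets become a Vandermonde product; it is even in \<open>k\<close>.
\<close>

definition qlattice :: "real \<Rightarrow> real \<Rightarrow> real" where
  "qlattice q k = q powr k + q powr (- k)"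

lemma qbracket_mult:
  assumes "0 < q"
  shows "qbracket q (b - a) * qbracket q (a + b) = q powr b * (qlattice q b - qlattice q a) / (1 - q)\<^sup>2"
proof -
  have "(1 - q powr (b - a)) * (1 - q powr (a + b)) = q powr b * (qlattice q b - qlattice q a)"
    using assms by (simp add: qlattice_def powr_add powr_diff powr_minus field_simps)
  then show ?thesis
    by (simp add: qbracket_def power2_eq_square)
qed

text \<open>
  Hence the factor that lowers \<open>c\<close> in \<open>rqfact q (c + k) * rqfact q (c - k)\<close> is linear in the
  lattice variable with its zero at \<open>qlattice q c\<close>: products of such factors are Newton basis
  polynomials.
\<close>

lemma qshift_mult:
  assumes "0 < q"
  shows "(1 - q powr (c + k)) * (1 - q powr (c - k)) = - (q powr c) * (qlattice q k - qlattice q c)"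
  using assms by (simp add: qlattice_def powr_add powr_diff powr_minus field_simps)

lemma qbinomial_eq_rqfact:
  assumes "a + b \<in> \<nat>" "a \<in> \<int>"
  shows "qbinomial q \<lfloor>a + b\<rfloor> \<lfloor>a\<rfloor> = qpoch q q (nat \<lfloor>a + b\<rfloor>) * (rqfact q a * rqfact q b)"
proof -
  obtain i where i: "a = of_int i" using assms(2) by (elim Ints_cases)
  obtain s where s: "a + b = real s" using assms(1) by (elim Nats_cases)
  have b: "b = of_int (int s - i)" using i s by simp
  have rq: "rqfact q (of_int j) = (if 0 \<le> j then 1 / qpoch q q (nat j) else 0)" for j
  proof (cases "0 \<le> j")
    case True
    then have "real_of_int j = real (nat j)" by simp
    then show ?thesis using True by (simp only: rqfact_of_nat if_True)
  qed (simp add: rqfact_neg)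
  show ?thesis
    unfolding s unfolding i b rq by (simp add: qbinomial_def)
qed

lemma rqfact_shift:
  assumes "0 < q" "q < 1" "n + k \<in> \<int>" "n - k \<in> \<int>"
  shows "rqfact q (n - real i + k) * rqfact q (n - real i - k)
    = rqfact q (n + k) * rqfact q (n - k)
      * (\<Prod>l<i. (1 - q powr (n - real l + k)) * (1 - q powr (n - real l - k)))"
proof (induction i)
  case (Suc i)
  have "n - real i + k = n + k - of_nat i" "n - real i - k = n - k - of_nat i" by simp_all
  then have I: "n - real i + k \<in> \<int>" "n - real i - k \<in> \<int>"
    using assms(3,4) by (simp_all only: Ints_diff Ints_of_nat)
  have "n - real (Suc i) + k = n - real i + k - 1" "n - real (Suc i) - k = n - real i - k - 1" by simp_all
  then have "rqfact q (n - real (Suc i) + k) * rqfact q (n - real (Suc i) - k)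
     = (rqfact q (n - real i + k) * rqfact q (n - real i - k))
       * ((1 - q powr (n - real i + k)) * (1 - q powr (n - real i - k)))"
    by (simp only: rqfact_minus_one[OF assms(1,2) I(1)] rqfact_minus_one[OF assms(1,2) I(2)] mult_ac)
  then show ?case
    unfolding Suc.IH by (simp only: prod.lessThan_Suc mult.assoc)
qed simp

lemma prod_pairs_swap:
  fixes f :: "nat \<Rightarrow> nat \<Rightarrow> 'a :: comm_monoid_mult"
  shows "(\<Prod>i = 1..r. \<Prod>j\<in>{i<..r}. f i j) = (\<Prod>j<r. \<Prod>i<j. f (Suc i) (Suc j))"
proof -
  have "(\<Prod>i = 1..r. \<Prod>j\<in>{i<..r}. f i j) = (\<Prod>(i, j)\<in>(SIGMA i:{1..r}. {i<..r}). f i j)"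
    by (simp add: prod.Sigma)
  also have "\<dots> = (\<Prod>(j, i)\<in>(SIGMA j:{..<r}. {..<j}). f (Suc i) (Suc j))"
    by (rule prod.reindex_bij_witness[of _ "\<lambda>(j, i). (Suc i, Suc j)" "\<lambda>(i, j). (j - 1, i - 1)"]) auto
  also have "\<dots> = (\<Prod>j<r. \<Prod>i<j. f (Suc i) (Suc j))"
    by (simp add: prod.Sigma)
  finally show ?thesis .
qed

lemma sum_PiE_Suc:
  fixes F :: "(nat \<Rightarrow> 'b) \<Rightarrow> 'a :: comm_monoid_add"
  assumes "\<And>k k'. (\<And>i. i < r \<Longrightarrow> k i = k' i) \<Longrightarrow> F k = F k'"
  shows "(\<Sum>k\<in>{1..r} \<rightarrow>\<^sub>E K. F (\<lambda>i. k (Suc i))) = (\<Sum>k\<in>{0..<r} \<rightarrow>\<^sub>E K. F k)"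
proof (rule sum.reindex_bij_witness[where
    i = "\<lambda>k. \<lambda>i\<in>{1..r}. k (i - 1)" and j = "\<lambda>k. \<lambda>i\<in>{0..<r}. k (Suc i)"])
  fix k assume "k \<in> {1..r} \<rightarrow>\<^sub>E K"
  then show "(\<lambda>i\<in>{1..r}. (\<lambda>i\<in>{0..<r}. k (Suc i)) (i - 1)) = k"
    by (intro ext) (auto simp: PiE_iff extensional_def restrict_def)
next
  fix k assume "k \<in> {0..<r} \<rightarrow>\<^sub>E K"
  then show "(\<lambda>i\<in>{0..<r}. (\<lambda>i\<in>{1..r}. k (i - 1)) (Suc i)) = k"
    by (intro ext) (auto simp: PiE_iff extensional_def restrict_def)
next
  fix k assume "k \<in> {0..<r} \<rightarrow>\<^sub>E K"
  then show "(\<lambda>i\<in>{1..r}. k (i - 1)) \<in> {1..r} \<rightarrow>\<^sub>E K"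
    by (fastforce simp: PiE_iff)
qed (auto intro!: assms)

text \<open>
  The Vandermonde square is written as a product of two Newton determinants, with nodes
  descending from \<open>n\<close> and from \<open>m\<close>. The leading coefficients of these bases are powers of \<open>q\<close> up
  to signs that cancel; together with the factors \<open>(1 - q)\<^sup>4\<close> from the brackets they form the
  denominator on the right.
\<close>

lemma lhs_sum_eq_det:
  assumes q: "0 < q" "q < 1" and n: "2 * n \<in> \<nat>" and m: "2 * m \<in> \<nat>" "m + n \<in> \<int>"
  shows "lhs_sum q r m n = fact r / (\<Prod>j<r. \<Prod>l<j. (1 - q) ^ 4 * q powr (m + n - 2 * real l))
     * (2 * qpoch q q (nat \<lfloor>2 * n\<rfloor>) * qpoch q q (nat \<lfloor>2 * m\<rfloor>) / (1 + q)) ^ r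
     * Determinant.det (mat r r (\<lambda>(i, j). moment q n (n - real i) (m - real j) (1/2)))"
proof -
  let ?K = "sum_range n"
  define w where "w k = q powr (k\<^sup>2 - k / 2) * ((1 + q powr k) / (1 + q))
    * qbinomial q \<lfloor>2 * n\<rfloor> \<lfloor>n + k\<rfloor> * qbinomial q \<lfloor>2 * m\<rfloor> \<lfloor>m + k\<rfloor>" for k
  define \<Delta> where "\<Delta> k = (\<Prod>j<r. \<Prod>l<j. qlattice q (k j) - qlattice q (k l))" for k :: "nat \<Rightarrow> real"
  define \<phi> where "\<phi> c i k = (\<Prod>l<i. (1 - q powr (c - real l + k)) * (1 - q powr (c - real l - k)))" for c k and i :: nat
  define C where "C = (\<Prod>j<r. \<Prod>l<j. (1 - q) ^ 4)"
  define Q where "Q = (\<Prod>j<r. \<Prod>l<j. q powr (m + n - 2 * real l))"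
  define B where "B = 2 * qpoch q q (nat \<lfloor>2 * n\<rfloor>) * qpoch q q (nat \<lfloor>2 * m\<rfloor>) / (1 + q)"
  have fin: "finite ?K" by (simp add: sum_range_def)
  have CQ: "C \<noteq> 0" "Q \<noteq> 0" using q by (simp_all add: C_def Q_def)
  have summand: "(\<Prod>i = 1..r. \<Prod>j \<in> {i<..r}. (qbracket q (k j - k i))\<^sup>2 * (qbracket q (k i + k j))\<^sup>2) *
        (\<Prod>i = 1..r. q powr ((k i)\<^sup>2 - (2 * real i - 3 / 2) * k i)
           * ((1 + q powr k i) / (1 + q))
           * qbinomial q \<lfloor>2 * n\<rfloor> \<lfloor>n + k i\<rfloor>
           * qbinomial q \<lfloor>2 * m\<rfloor> \<lfloor>m + k i\<rfloor>)
      = (\<lambda>k. (\<Delta> k)\<^sup>2 * (\<Prod>j<r. w (k j)) / C) (\<lambda>i. k (Suc i))" for k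
  proof -
    have 1: "(qbracket q (k j - k i))\<^sup>2 * (qbracket q (k i + k j))\<^sup>2
       = (q powr (k j))\<^sup>2 * ((qlattice q (k j) - qlattice q (k i))\<^sup>2 / (1 - q) ^ 4)" for i j
      unfolding power_mult_distrib[symmetric] qbracket_mult[OF q(1)]
      by (simp add: power_mult_distrib power_divide flip: power_mult)
    \<comment> \<open>the exponent loses its dependence on the index of the variable\<close>
    have 2: "q powr ((k i)\<^sup>2 - (2 * real (Suc j) - 3 / 2) * k i) * ((q powr k i)\<^sup>2) ^ j = q powr ((k i)\<^sup>2 - k i / 2)" for i j
    proof -
      have "((q powr k i)\<^sup>2) ^ j = q powr (2 * real j * k i)"
        using q by (simp add: powr_power mult_ac flip: power_mult)
      then show ?thesis by (simp add: powr_add[symmetric] algebra_simps)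
    qed
    have "(\<Prod>i = 1..r. \<Prod>j \<in> {i<..r}. (qbracket q (k j - k i))\<^sup>2 * (qbracket q (k i + k j))\<^sup>2)
      = (\<Prod>j<r. ((q powr (k (Suc j)))\<^sup>2) ^ j) * ((\<Delta> (\<lambda>i. k (Suc i)))\<^sup>2 / C)"
      unfolding 1 prod_pairs_swap \<Delta>_def C_def
      by (simp add: prod.distrib prod_dividef prod_power_distrib)
    moreover have "(\<Prod>i = 1..r. q powr ((k i)\<^sup>2 - (2 * real i - 3 / 2) * k i)
           * ((1 + q powr k i) / (1 + q))
           * qbinomial q \<lfloor>2 * n\<rfloor> \<lfloor>n + k i\<rfloor>
           * qbinomial q \<lfloor>2 * m\<rfloor> \<lfloor>m + k i\<rfloor>) * (\<Prod>j<r. ((q powr (k (Suc j)))\<^sup>2) ^ j)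
        = (\<Prod>j<r. w (k (Suc j)))"
      unfolding One_nat_def prod.atLeast1_atMost_eq prod.distrib[symmetric] w_def
      by (intro prod.cong refl, subst 2[of "Suc j" j for j, symmetric]) (simp only: mult_ac)
    ultimately show ?thesis by (simp add: mult_ac)
  qed
  have "lhs_sum q r m n = (\<Sum>k\<in>{0..<r} \<rightarrow>\<^sub>E ?K. (\<Delta> k)\<^sup>2 * (\<Prod>j<r. w (k j)) / C)"
    unfolding lhs_sum_def summand
    by (rule sum_PiE_Suc) (auto simp: \<Delta>_def intro!: arg_cong2[where f = "(*)"] arg_cong[where f = "\<lambda>x. x\<^sup>2"] arg_cong2[where f = "(/)"] prod.cong)
  also have "\<dots> = (\<Sum>k\<in>{0..<r} \<rightarrow>\<^sub>E ?K. Determinant.det (mat r r (\<lambda>(i, j). w (k j) * \<phi> n i (k j)))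
       * Determinant.det (mat r r (\<lambda>(i, j). \<phi> m i (k j)))) / (Q * C)"
  proof -
    \<comment> \<open>the leading coefficients of the Newton basis with nodes descending from \<open>c\<close>\<close>
    have vdm: "Determinant.det (mat r r (\<lambda>(i, j). \<phi> c i (k j))) = (\<Prod>j<r. \<Prod>l<j. - (q powr (c - real l))) * \<Delta> k" for c k
    proof -
      have "\<phi> c i x = (\<Prod>l<i. - (q powr (c - real l))) * 1 * (\<Prod>l<i. qlattice q x - qlattice q (c - real l))" for i x
        by (simp only: \<phi>_def qshift_mult[OF q(1)] prod.distrib mult_1_right)
      then show ?thesis
        by (simp only: det_scale_rows_cols det_newton_basis \<Delta>_def) simp
    qed
    have "(\<Prod>j<r. \<Prod>l<j. - (q powr (n - real l))) * (\<Prod>j<r. \<Prod>l<j. - (q powr (m - real l))) = Q"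
      unfolding Q_def prod.distrib[symmetric] by (simp add: powr_add[symmetric] algebra_simps)
    then have "Determinant.det (mat r r (\<lambda>(i, j). w (k j) * \<phi> n i (k j)))
       * Determinant.det (mat r r (\<lambda>(i, j). \<phi> m i (k j))) = Q * ((\<Delta> k)\<^sup>2 * (\<Prod>j<r. w (k j)))" for k
      using det_scale_rows_cols[of r "\<lambda>_. 1" "\<lambda>j. w (k j)" "\<lambda>i j. \<phi> n i (k j)"]
      by (simp add: vdm power2_eq_square mult_ac)
    then show ?thesis
      using CQ by (simp add: sum_divide_distrib)
  qed
  also have "\<dots> = fact r * Determinant.det (mat r r (\<lambda>(i, j). \<Sum>k\<in>?K. w k * \<phi> n i k * \<phi> m j k)) / (Q * C)"
    by (simp add: andreief[OF fin, of r "\<lambda>i k. w k * \<phi> n i k" "\<phi> m"])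
  also have "mat r r (\<lambda>(i, j). \<Sum>k\<in>?K. w k * \<phi> n i k * \<phi> m j k)
     = mat r r (\<lambda>(i, j). B * 1 * moment q n (n - real i) (m - real j) (1/2))"
  proof (rule cong_mat)
    fix i j :: nat
    have "w k * \<phi> n i k * \<phi> m j k = B / 2 * (moment_kernel q (n - real i) (m - real j) k * q powr (1/2 * k)
        + moment_kernel q (n - real i) (m - real j) k * q powr (- (1/2) * k))" if k: "k \<in> ?K" for k
    proof -
      have "n + n \<in> \<int>" using n Nats_subset_Ints by auto
      note I = Ints_sum_range[OF this n k] Ints_sum_range[OF m(2) n k]
      have b1: "qbinomial q \<lfloor>2 * n\<rfloor> \<lfloor>n + k\<rfloor> = qpoch q q (nat \<lfloor>2 * n\<rfloor>) * (rqfact q (n + k) * rqfact q (n - k))"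
        using qbinomial_eq_rqfact[of "n + k" "n - k"] n I by simp
      have b2: "qbinomial q \<lfloor>2 * m\<rfloor> \<lfloor>m + k\<rfloor> = qpoch q q (nat \<lfloor>2 * m\<rfloor>) * (rqfact q (m + k) * rqfact q (m - k))"
        using qbinomial_eq_rqfact[of "m + k" "m - k"] m I by simp
      have e: "q powr (k\<^sup>2 - k / 2) * (1 + q powr k) = q powr (k\<^sup>2) * (q powr (1/2 * k) + q powr (- (1/2) * k))"
        by (simp add: distrib_left powr_add[symmetric] add.commute)
      have s: "moment_kernel q (n - real i) (m - real j) k = q powr (k\<^sup>2) *
         ((rqfact q (n + k) * rqfact q (n - k) * \<phi> n i k) * (rqfact q (m + k) * rqfact q (m - k) * \<phi> m j k))"
        unfolding moment_kernel_def \<phi>_def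
        using rqfact_shift[OF q I(1,2), of i] rqfact_shift[OF q I(3,4), of j] by simp
      have B2: "B / 2 = qpoch q q (nat \<lfloor>2 * n\<rfloor>) * qpoch q q (nat \<lfloor>2 * m\<rfloor>) / (1 + q)"
        using q by (simp add: B_def field_simps)
      have "w k * \<phi> n i k * \<phi> m j k = (q powr (k\<^sup>2 - k / 2) * (1 + q powr k)) / (1 + q) *
         (qpoch q q (nat \<lfloor>2 * n\<rfloor>) * qpoch q q (nat \<lfloor>2 * m\<rfloor>)) *
         ((rqfact q (n + k) * rqfact q (n - k) * \<phi> n i k) * (rqfact q (m + k) * rqfact q (m - k) * \<phi> m j k))"
        unfolding w_def b1 b2 by simp
      also have "\<dots> = B / 2 * (moment_kernel q (n - real i) (m - real j) k * q powr (1/2 * k)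
        + moment_kernel q (n - real i) (m - real j) k * q powr (- (1/2) * k))"
        unfolding e s B2 by (simp add: algebra_simps add_divide_distrib)
      finally show ?thesis .
    qed
    then have "(\<Sum>k\<in>?K. w k * \<phi> n i k * \<phi> m j k) = B / 2 * (moment q n (n - real i) (m - real j) (1/2)
        + moment q n (n - real i) (m - real j) (- (1/2)))"
      unfolding moment_def sum.distrib[symmetric] sum_distrib_left by (intro sum.cong) auto
    then show "(case (i, j) of (i, j) \<Rightarrow> \<Sum>k\<in>?K. w k * \<phi> n i k * \<phi> m j k)
        = (case (i, j) of (i, j) \<Rightarrow> B * 1 * moment q n (n - real i) (m - real j) (1/2))"
      unfolding moment_uminus[OF n] by simp
  qed simp_all
  finally show ?thesis
    by (simp only: det_scale_rows_cols prod_constant card_lessThan) 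
       (simp add: C_def Q_def B_def prod.distrib mult_ac)
qed

section \<open>The q-Gamma function\<close>

lemma convergent_prod_qpoch:
  fixes a q :: real
  assumes "0 < q" "q < 1"
  shows "convergent_prod (\<lambda>k. 1 - a * q ^ k)"
proof -
  have "summable (\<lambda>k. norm (1 - a * q ^ k - 1))"
    using assms by (simp add: abs_mult summable_mult power_abs)
  then show ?thesis
    by (intro abs_convergent_prod_imp_convergent_prod summable_imp_abs_convergent_prod)
qed

lemma qpoch_lessThan: "qpoch a q k = (\<Prod>j<k. 1 - a * q ^ j)"
  by (induction k) (simp_all add: qpoch_Suc)

lemma qpoch_LIMSEQ:
  assumes "0 < q" "q < 1"
  shows "(\<lambda>k. qpoch a q k) \<longlonglongrightarrow> qpoch_inf a q"
proof -
  have "(\<lambda>k. qpoch a q (Suc k)) \<longlonglongrightarrow> qpoch_inf a q"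
    using convergent_prod_LIMSEQ[OF convergent_prod_qpoch[OF assms]]
    by (simp only: qpoch_lessThan lessThan_Suc_atMost qpoch_inf_def)
  then show ?thesis by (rule LIMSEQ_imp_Suc)
qed

lemma qpoch_inf_split:
  assumes "0 < q" "q < 1"
  shows "qpoch_inf a q = qpoch a q k * qpoch_inf (a * q ^ k) q"
proof (rule LIMSEQ_unique)
  show "(\<lambda>n. qpoch a q (n + k)) \<longlonglongrightarrow> qpoch_inf a q"
    by (rule LIMSEQ_ignore_initial_segment[OF qpoch_LIMSEQ[OF assms]])
  have "qpoch a q (n + k) = qpoch a q k * qpoch (a * q ^ k) q n" for n
    by (induction n) (simp_all add: qpoch_Suc power_add mult_ac)
  then show "(\<lambda>n. qpoch a q (n + k)) \<longlonglongrightarrow> qpoch a q k * qpoch_inf (a * q ^ k) q"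
    by (simp only:) (intro tendsto_intros qpoch_LIMSEQ[OF assms])
qed

lemma qpoch_inf_sqrt:
  assumes "0 < q" "q < 1" and p: "p\<^sup>2 = q" "0 < p" "p < 1"
  shows "qpoch_inf a p = qpoch_inf a q * qpoch_inf (a * p) q"
proof (rule LIMSEQ_unique)
  show "(\<lambda>n. qpoch a p (2 * n)) \<longlonglongrightarrow> qpoch_inf a p"
    using LIMSEQ_subseq_LIMSEQ[OF qpoch_LIMSEQ[OF p(2,3)], of "\<lambda>n. 2 * n"]
    by (simp add: strict_mono_def comp_def)
  have "qpoch a p (2 * n) = qpoch a q n * qpoch (a * p) q n" for n
    by (induction n) (simp_all add: qpoch_Suc p(1)[symmetric] power_mult[symmetric] mult_ac)
  then show "(\<lambda>n. qpoch a p (2 * n)) \<longlonglongrightarrow> qpoch_inf a q * qpoch_inf (a * p) q"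
    by (simp only:) (intro tendsto_intros qpoch_LIMSEQ[OF assms(1,2)])
qed

lemma qpoch_inf_powr_eq_0_iff:
  assumes "0 < q" "q < 1"
  shows "qpoch_inf (q powr x) q = 0 \<longleftrightarrow> x \<in> \<int>\<^sub>\<le>\<^sub>0"
proof
  assume 0: "qpoch_inf (q powr x) q = 0"
  have "\<exists>k. 1 - q powr x * q ^ k = 0"
    using prodinf_nonzero[OF convergent_prod_qpoch[OF assms, of "q powr x"]] 0
    unfolding qpoch_inf_def by blast
  then obtain k where "q powr x * q ^ k = 1" by auto
  then have "q powr (x + real k) = 1"
    using assms by (simp add: powr_add powr_realpow)
  then have "x + real k = 0" using assms by (simp add: powr_eq_one_iff_gen)
  then have "x = of_int (- int k)" by simp
  then show "x \<in> \<int>\<^sub>\<le>\<^sub>0" by (auto intro: nonpos_Ints_of_int)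
next
  assume "x \<in> \<int>\<^sub>\<le>\<^sub>0"
  then obtain k where "x = - real k" by (elim nonpos_Ints_cases') simp
  then have "q powr x * q ^ k = 1"
    using assms by (simp add: powr_minus powr_realpow)
  then have "qpoch (q powr x) q (Suc k) = 0" by (simp add: qpoch_Suc)
  then show "qpoch_inf (q powr x) q = 0"
    using qpoch_inf_split[OF assms, of "q powr x" "Suc k"] by simp
qed

lemma qpoch_inf_self_nonzero: "0 < q \<Longrightarrow> q < 1 \<Longrightarrow> qpoch_inf q q \<noteq> 0"
  using qpoch_inf_powr_eq_0_iff[of q 1] by (auto elim: nonpos_Ints_cases)

text \<open>
  On a bounded set of \<open>a\<close> the partial products converge uniformly, by the Weierstrass test.
\<close>

lemma isCont_qpoch_inf:
  assumes "0 < q" "q < 1"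
  shows "isCont (\<lambda>a. qpoch_inf a q) a"
proof -
  define R where "R = \<bar>a\<bar> + 1"
  let ?A = "cball (0 :: real) R"
  have "uniformly_convergent_on ?A (\<lambda>N x. \<Sum>k<N. norm (- x * q ^ k))"
  proof (rule Weierstrass_m_test')
    show "norm (norm (- x * q ^ k)) \<le> R * q ^ k" if "x \<in> ?A" for k x
      using that assms by (auto simp: abs_mult power_abs intro!: mult_right_mono)
    show "summable (\<lambda>k. R * q ^ k)" using assms by (intro summable_mult) simp
  qed
  then have "uniformly_convergent_on ?A (\<lambda>N x. \<Prod>k<N. 1 + (- x * q ^ k))"
    by (intro uniformly_convergent_on_prod continuous_intros) simp_all
  then have "uniformly_convergent_on ?A (\<lambda>N x. qpoch x q N)"
    by (simp add: qpoch_lessThan)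
  then have "uniform_limit ?A (\<lambda>N x. qpoch x q N) (\<lambda>x. lim (\<lambda>N. qpoch x q N)) sequentially"
    using uniformly_convergent_uniform_limit_iff by blast
  moreover have "lim (\<lambda>N. qpoch x q N) = qpoch_inf x q" for x
    by (rule limI[OF qpoch_LIMSEQ[OF assms]])
  ultimately have "uniform_limit ?A (\<lambda>N x. qpoch x q N) (\<lambda>x. qpoch_inf x q) sequentially" by simp
  then have "continuous_on ?A (\<lambda>x. qpoch_inf x q)"
    by (rule uniform_limit_theorem[rotated])
       (auto intro!: always_eventually continuous_intros simp: qpoch_lessThan)
  then have "continuous_on (ball 0 R) (\<lambda>x. qpoch_inf x q)"
    by (rule continuous_on_subset) auto
  then show ?thesis
    by (simp add: continuous_on_eq_continuous_at R_def)
qed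

lemma qGamma_Suc_of_nat:
  assumes "0 < q" "q < 1" "x = real k + 1"
  shows "qGamma q x = (1 - q) powr (- real k) * qpoch q q k"
proof -
  have "q powr x = q * q ^ k"
    using assms by (simp add: powr_add powr_realpow)
  then have "qpoch_inf q q = qpoch q q k * qpoch_inf (q powr x) q"
    using qpoch_inf_split[OF assms(1,2), of q k] by simp
  then show ?thesis
    using qpoch_inf_self_nonzero[OF assms(1,2)] assms(3) by (simp add: qGamma_def)
qed

lemma qGamma_nonpos_Int: "0 < q \<Longrightarrow> q < 1 \<Longrightarrow> x \<in> \<int>\<^sub>\<le>\<^sub>0 \<Longrightarrow> qGamma q x = 0"
  by (simp add: qGamma_def qpoch_inf_powr_eq_0_iff)

lemma isCont_inverse_qGamma:
  assumes "0 < q" "q < 1"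
  shows "isCont (\<lambda>x. inverse (qGamma q x)) x"
proof -
  have "isCont (\<lambda>x. qpoch_inf (q powr x) q) x"
    by (rule isCont_o2[OF _ isCont_qpoch_inf[OF assms]]) (use assms in \<open>auto intro!: continuous_intros\<close>)
  then show ?thesis
    unfolding qGamma_def inverse_divide
    using assms qpoch_inf_self_nonzero[OF assms] by (intro continuous_intros) auto
qed

lemma isCont_qGamma:
  assumes "0 < q" "q < 1" "x \<notin> \<int>\<^sub>\<le>\<^sub>0"
  shows "isCont (qGamma q) x"
proof -
  have "qGamma q x \<noteq> 0"
    using assms qpoch_inf_self_nonzero[OF assms(1,2)] by (simp add: qGamma_def qpoch_inf_powr_eq_0_iff)
  then have "isCont (\<lambda>x. inverse (inverse (qGamma q x))) x"
    by (intro continuous_intros isCont_inverse_qGamma assms(1,2)) simp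
  then show ?thesis by simp
qed

text \<open>
  The quotient \<open>\<Gamma>\<^sub>p(2y - 1) / \<Gamma>\<^sub>q(y)\<close> with \<open>p = q\<^sup>1\<^sup>/\<^sup>2\<close>, after cancelling the factor \<open>(q\<^sup>y;q)\<^sub>\<infinity>\<close> that
  carries the poles of both at the non-positive integers \<open>y\<close>.
\<close>

definition qGamma_dup :: "real \<Rightarrow> real \<Rightarrow> real" where
  "qGamma_dup q y = (1 - q powr (1/2)) powr (2 - 2 * y) * (1 - q) powr (y - 1)
     * qpoch_inf (q powr (1/2)) (q powr (1/2)) / (qpoch_inf q q * qpoch_inf (q powr (y - 1/2)) q)"

lemma qGamma_sqrt_quotient:
  assumes "0 < q" "q < 1" "y \<notin> \<int>\<^sub>\<le>\<^sub>0"
  shows "qGamma (q powr (1/2)) (2 * y - 1) / qGamma q y = qGamma_dup q y"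
proof -
  let ?p = "q powr (1/2)"
  have p: "?p\<^sup>2 = q" "0 < ?p" "?p < 1"
    using assms by (auto simp: powr_power powr_half_sqrt)
  have "?p powr (2 * y - 1) = q powr (y - 1/2)"
    by (simp add: powr_powr algebra_simps)
  moreover have "q powr (y - 1/2) * ?p = q powr y"
    by (simp add: powr_add[symmetric])
  ultimately have "qpoch_inf (?p powr (2 * y - 1)) ?p = qpoch_inf (q powr (y - 1/2)) q * qpoch_inf (q powr y) q"
    using qpoch_inf_sqrt[OF assms(1,2) p, of "q powr (y - 1/2)"] by simp
  moreover have "qpoch_inf (q powr y) q \<noteq> 0"
    using assms by (simp add: qpoch_inf_powr_eq_0_iff)
  moreover have "(1 - q) powr (1 - y) = inverse ((1 - q) powr (y - 1))"
    using powr_minus[of "1 - q" "y - 1"] by simp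
  moreover have "1 - (2 * y - 1) = 2 - 2 * y" by simp
  moreover have alg: "(A * P / (Z * W)) / (inverse X * Q / W) = A * X * P / (Q * Z)" if "W \<noteq> 0" for A P Z W X Q :: real
    using that by (simp add: field_simps)
  ultimately show ?thesis
    unfolding qGamma_def qGamma_dup_def by (simp only: alg)
qed

lemma isCont_qGamma_dup:
  assumes "0 < q" "q < 1" "y - 1/2 \<notin> \<int>\<^sub>\<le>\<^sub>0"
  shows "isCont (qGamma_dup q) y"
proof -
  have "isCont (\<lambda>y. qpoch_inf (q powr (y - 1/2)) q) y"
    by (rule isCont_o2[OF _ isCont_qpoch_inf[OF assms(1,2)]]) (use assms in \<open>auto intro!: continuous_intros\<close>)
  moreover have "q powr (1/2) < 1" using assms by (simp add: powr_half_sqrt)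
  ultimately show ?thesis
    unfolding qGamma_dup_def
    using assms qpoch_inf_self_nonzero[OF assms(1,2)]
    by (intro continuous_intros) (auto simp: qpoch_inf_powr_eq_0_iff)
qed

section \<open>The degenerate case: r - 1 exceeds n or m\<close>

text \<open>
  One of \<open>c + k\<close> and \<open>c - k\<close> is negative if \<open>c\<close> is.
\<close>

lemma moment_neg:
  assumes "n < 0 \<or> m < 0"
  shows "moment q n0 n m s = 0"
proof -
  have "rqfact q (c + k) * rqfact q (c - k) = 0" if "c < 0" for c k
  proof -
    have "c + k < 0 \<or> c - k < 0" using that by linarith
    then show ?thesis by (auto simp: rqfact_neg)
  qed
  moreover have "moment_kernel q n m k = q powr (k\<^sup>2)
      * ((rqfact q (n + k) * rqfact q (n - k)) * (rqfact q (m + k) * rqfact q (m - k)))" for k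
    by (simp only: moment_kernel_def mult.assoc)
  ultimately have "moment_kernel q n m k = 0" for k
    using assms by (metis mult_zero_left mult_zero_right)
  then show ?thesis by (simp add: moment_def)
qed

lemma det_zero_row:
  fixes a :: "nat \<Rightarrow> nat \<Rightarrow> 'a :: comm_ring_1"
  assumes "l < r" "\<And>j. a l j = 0"
  shows "Determinant.det (mat r r (\<lambda>(i, j). a i j)) = 0"
proof -
  have "Determinant.det (mat r r (\<lambda>(i, j). a i j))
      = Determinant.det (mat r r (\<lambda>(i, j). (if i = l then 0 else 1) * 1 * a i j))"
    using assms(2) by (intro arg_cong[where f = Determinant.det] cong_mat) auto
  also have "\<dots> =
     (\<Prod>i<r. if i = l then 0 else 1) * (\<Prod>j<r. 1) * Determinant.det (mat r r (\<lambda>(i, j). a i j))"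
    by (rule det_scale_rows_cols)
  also have "(\<Prod>i<r. if i = l then 0 else 1 :: 'a) = 0"
    using assms(1) by (intro prod_zero) auto
  finally show ?thesis by simp
qed

lemma det_zero_col:
  fixes a :: "nat \<Rightarrow> nat \<Rightarrow> 'a :: comm_ring_1"
  assumes "l < r" "\<And>i. a i l = 0"
  shows "Determinant.det (mat r r (\<lambda>(i, j). a i j)) = 0"
proof -
  have "Determinant.det (mat r r (\<lambda>(i, j). a i j))
      = Determinant.det (mat r r (\<lambda>(i, j). 1 * (if j = l then 0 else 1) * a i j))"
    using assms(2) by (intro arg_cong[where f = Determinant.det] cong_mat) auto
  also have "\<dots> =
     (\<Prod>i<r. 1) * (\<Prod>j<r. if j = l then 0 else 1) * Determinant.det (mat r r (\<lambda>(i, j). a i j))"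
    by (rule det_scale_rows_cols)
  also have "(\<Prod>i<r. if i = l then 0 else 1 :: 'a) = 0"
    using assms(1) by (intro prod_zero) auto
  finally show ?thesis by simp
qed

lemma lhs_sum_degenerate:
  assumes "0 < q" "q < 1" and "2 * n \<in> \<nat>" "2 * m \<in> \<nat>" "m + n \<in> \<int>"
    and r: "r \<ge> 1" "n < real r - 1 \<or> m < real r - 1"
  shows "lhs_sum q r m n = 0"
proof -
  have "Determinant.det (mat r r (\<lambda>(i, j). moment q n (n - real i) (m - real j) (1/2))) = 0"
    using r(2)
  proof
    assume "n < real r - 1"
    then show ?thesis using r(1)
      by (intro det_zero_row[of "r - 1"]) (auto simp: of_nat_diff intro!: moment_neg)
  next
    assume "m < real r - 1"
    then show ?thesis using r(1)
      by (intro det_zero_col[of "r - 1"]) (auto simp: of_nat_diff intro!: moment_neg)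
  qed
  then show ?thesis by (simp add: lhs_sum_eq_det[OF assms(1-5)])
qed

text \<open>
  The number on the left of the membership is an integer below 1.
\<close>

lemma nonpos_Ints_degenerate:
  assumes "2 * c \<in> \<nat>" "c < real r - 1"
  shows "2 * c - 2 * real r + 3 \<in> \<int>\<^sub>\<le>\<^sub>0"
proof -
  obtain k where k: "2 * c = real k" using assms(1) by (elim Nats_cases)
  have "2 * c - 2 * real r + 3 = of_int (int k - 2 * int r + 3)" by (simp add: k)
  moreover have "int k - 2 * int r + 3 \<le> 0" using assms(2) k by linarith
  ultimately show ?thesis by (metis nonpos_Ints_of_int)
qed

lemma rhs_product_degenerate:
  assumes "0 < q" "q < 1" "2 * n \<in> \<nat>" "2 * m \<in> \<nat>"
    and r: "r \<ge> 1" "n < real r - 1 \<or> m < real r - 1"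
  shows "rhs_product q r m n = 0"
proof -
  have p: "0 < q powr (1/2)" "q powr (1/2) < 1" using assms by (auto simp: powr_half_sqrt)
  have "qGamma (q powr (1/2)) (2 * n - 2 * real r + 3) = 0 \<or> qGamma (q powr (1/2)) (2 * m - 2 * real r + 3) = 0"
    using nonpos_Ints_degenerate assms(3,4) r(2) qGamma_nonpos_Int[OF p] by blast
  then show ?thesis
    using r(1) unfolding rhs_product_def
    by (intro mult_eq_0_iff[THEN iffD2] disjI2 prod_zero bexI[of _ r]) auto
qed

text \<open>
  Each factor of the product has a finite limit once \<open>\<Gamma>\<^sub>p(2y - 1) / \<Gamma>\<^sub>q(y)\<close> is replaced by its
  continuous form \<open>qGamma_dup\<close>, which is legitimate off the integers and thus in a punctured
  neighbourhood of 0. The limit of the factor \<open>i = r\<close> contains the value of \<open>1 / \<Gamma>\<^sub>p\<close> at a pole.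
\<close>

lemma rhs_product_degenerate_tendsto:
  assumes q: "0 < q" "q < 1" and n: "2 * n \<in> \<nat>" and m: "2 * m \<in> \<nat>" and mn: "m + n \<in> \<int>"
    and r: "r \<ge> 1" "n < real r - 1 \<or> m < real r - 1"
  shows "((\<lambda>\<epsilon>. rhs_product q r (m + \<epsilon>) (n + \<epsilon>)) \<longlongrightarrow> 0) (at 0)"
proof -
  let ?p = "q powr (1/2)"
  have p: "0 < ?p" "?p < 1" using q by (auto simp: powr_half_sqrt)
  define y where "y i \<epsilon> = m + n - real i - real r + 3 + 2 * \<epsilon>" for i :: nat and \<epsilon> :: real
  define g where "g i \<epsilon> = qGamma ?p (2 * real i - 1) * qGamma q (2 * (n + \<epsilon>) + 1) * qGamma q (2 * (m + \<epsilon>) + 1)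
     * inverse (qGamma q (m + \<epsilon> + (n + \<epsilon>) - real i + 2)) * qGamma_dup q (y i \<epsilon>)
     * (inverse (qGamma ?p (2 * (n + \<epsilon>) - 2 * real i + 3)) * inverse (qGamma ?p (2 * (m + \<epsilon>) - 2 * real i + 3)))"
    for i \<epsilon>
  define C where "C = fact r * (2 / qbracket q 2) ^ r
     * q powr (- 2 * real ((r + 1) choose 3) + 1 / 2 * real (r choose 2))"
  obtain N where N: "m + n = of_int N" using mn by (elim Ints_cases)
  have nm0: "2 * n \<ge> 0" "2 * m \<ge> 0" using n m by (auto elim!: Nats_cases)
  \<comment> \<open>for these \<open>\<epsilon>\<close> the shift \<open>2 \<epsilon>\<close> is not an integer, so \<open>y i \<epsilon>\<close> is none either\<close>
  have "eventually (\<lambda>\<epsilon>::real. \<epsilon> \<noteq> 0 \<and> \<bar>\<epsilon>\<bar> < 1/2) (at 0)"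
    unfolding eventually_at by (rule exI[of _ "1/2"]) (auto simp: dist_real_def)
  then have ev: "eventually (\<lambda>\<epsilon>. C * (\<Prod>i = 1..r. g i \<epsilon>) = rhs_product q r (m + \<epsilon>) (n + \<epsilon>)) (at 0)"
  proof eventually_elim
    case (elim \<epsilon>)
    have "y i \<epsilon> \<notin> \<int>" for i
    proof
      assume "y i \<epsilon> \<in> \<int>"
      then obtain k where "y i \<epsilon> = of_int k" by (elim Ints_cases)
      then have "2 * \<epsilon> = of_int (k - N + int i + int r - 3)" using N by (simp add: y_def)
      moreover from this elim have "\<bar>k - N + int i + int r - 3\<bar> < 1" by linarith
      ultimately show False using elim by simp
    qed
    then have y: "y i \<epsilon> \<notin> \<int>\<^sub>\<le>\<^sub>0" for i using nonpos_Ints_subset_Ints by blast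
    have "g i \<epsilon> = (qGamma ?p (2 * real i - 1)
             * qGamma q (2 * (n + \<epsilon>) + 1) * qGamma q (2 * (m + \<epsilon>) + 1))
          / (qGamma q (m + \<epsilon> + (n + \<epsilon>) - real i + 2) * qGamma q (m + \<epsilon> + (n + \<epsilon>) - real i - real r + 3))
          * (qGamma ?p (2 * (m + \<epsilon>) + 2 * (n + \<epsilon>) - 2 * real i - 2 * real r + 5)
             / (qGamma ?p (2 * (n + \<epsilon>) - 2 * real i + 3)
                * qGamma ?p (2 * (m + \<epsilon>) - 2 * real i + 3)))" for i
    proof -
      have "m + \<epsilon> + (n + \<epsilon>) - real i - real r + 3 = y i \<epsilon>"
        "2 * (m + \<epsilon>) + 2 * (n + \<epsilon>) - 2 * real i - 2 * real r + 5 = 2 * y i \<epsilon> - 1"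
        by (simp_all add: y_def)
      moreover have "a * b * c * inverse d * (e / f) * (inverse g * inverse h) = (a * b * c) / (d * f) * (e / (g * h))"
        for a b c d e f g h :: real by (simp only: divide_inverse inverse_mult_distrib mult_ac)
      ultimately show ?thesis
        unfolding g_def qGamma_sqrt_quotient[OF q y, symmetric] by (simp only:)
    qed
    then show ?case unfolding rhs_product_def C_def by (rule arg_cong2[where f = "(*)", OF refl prod.cong[OF refl]])
  qed
  have g: "(g i \<longlongrightarrow> g i 0) (at 0)" for i
  proof -
    \<comment> \<open>at \<open>\<epsilon> = 0\<close> the argument of the remaining infinite product is a half-integer\<close>
    have "y i 0 - 1/2 \<notin> \<int>\<^sub>\<le>\<^sub>0"
    proof
      assume "y i 0 - 1/2 \<in> \<int>\<^sub>\<le>\<^sub>0"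
      then obtain k where "y i 0 - 1/2 = of_int k" by (elim nonpos_Ints_cases)
      then have "of_int (2 * N - 2 * int i - 2 * int r + 5) = (of_int (2 * k) :: real)"
        using N by (simp add: y_def)
      then have "2 * N - 2 * int i - 2 * int r + 5 = 2 * k" by (simp only: of_int_eq_iff)
      then show False by presburger
    qed
    then have 1: "isCont (\<lambda>\<epsilon>. qGamma_dup q (y i \<epsilon>)) 0"
      by (intro isCont_o2[OF _ isCont_qGamma_dup[OF q]]) (auto simp: y_def intro!: continuous_intros)
    have 2: "isCont (\<lambda>\<epsilon>. qGamma q (2 * (c + \<epsilon>) + 1)) 0" if "2 * c \<ge> 0" for c
      using that by (intro isCont_o2[OF _ isCont_qGamma[OF q]])
        (auto intro!: continuous_intros elim!: nonpos_Ints_cases)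
    have 3: "isCont (\<lambda>\<epsilon>. inverse (qGamma ?p (2 * (c + \<epsilon>) - 2 * real i + 3))) 0" for c
      by (intro isCont_o2[OF _ isCont_inverse_qGamma[OF p]]) (auto intro!: continuous_intros)
    have 4: "isCont (\<lambda>\<epsilon>. inverse (qGamma q (m + \<epsilon> + (n + \<epsilon>) - real i + 2))) 0"
      by (intro isCont_o2[OF _ isCont_inverse_qGamma[OF q]]) (auto intro!: continuous_intros)
    have "isCont (g i) 0"
      unfolding g_def by (intro continuous_intros 1 2 3 4 nm0)
    then show ?thesis by (simp add: isCont_def)
  qed
  have "g r 0 = 0"
  proof -
    have "qGamma ?p (2 * n - 2 * real r + 3) = 0 \<or> qGamma ?p (2 * m - 2 * real r + 3) = 0"
      using nonpos_Ints_degenerate n m r(2) qGamma_nonpos_Int[OF p] by blast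
    then show ?thesis by (auto simp: g_def)
  qed
  then have "C * (\<Prod>i = 1..r. g i 0) = 0"
    using r(1) by (intro mult_eq_0_iff[THEN iffD2] disjI2 prod_zero bexI[of _ r]) auto
  moreover have "((\<lambda>\<epsilon>. C * (\<Prod>i = 1..r. g i \<epsilon>)) \<longlongrightarrow> C * (\<Prod>i = 1..r. g i 0)) (at 0)"
    by (intro tendsto_intros g)
  ultimately show ?thesis
    using Lim_transform_eventually[OF _ ev] by (simp only:)
qed

section \<open>The non-degenerate case\<close>

lemma prod_powr_linear:
  fixes x :: real
  assumes "0 < x"
  shows "(\<Prod>t<r. x powr (\<alpha> + \<beta> * real t)) = x powr (\<alpha> * real r + \<beta> * (real r * (real r - 1) / 2))"
proof (induction r)
  case (Suc r)
  have "\<alpha> * real (Suc r) + \<beta> * (real (Suc r) * (real (Suc r) - 1) / 2)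
      = (\<alpha> * real r + \<beta> * (real r * (real r - 1) / 2)) + (\<alpha> + \<beta> * real r)"
    by (simp add: field_simps)
  then show ?case using Suc by (simp add: powr_add)
qed (use assms in simp)

lemma prod_powr_quadratic:
  fixes x :: real
  assumes "0 < x"
  shows "(\<Prod>t<r. x powr (\<alpha> * real t + \<beta> * (real t * (real t - 1))))
    = x powr (\<alpha> * (real r * (real r - 1) / 2) + \<beta> * (real r * (real r - 1) * (real r - 2) / 3))"
proof (induction r)
  case (Suc r)
  have "\<alpha> * (real (Suc r) * (real (Suc r) - 1) / 2) + \<beta> * (real (Suc r) * (real (Suc r) - 1) * (real (Suc r) - 2) / 3)
      = (\<alpha> * (real r * (real r - 1) / 2) + \<beta> * (real r * (real r - 1) * (real r - 2) / 3))
        + (\<alpha> * real r + \<beta> * (real r * (real r - 1)))"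
    by (simp add: field_simps)
  then show ?case using Suc by (simp add: powr_add)
qed (use assms in simp)

lemma real_choose_2: "real (r choose 2) = real r * (real r - 1) / 2"
  by (induction r) (simp_all add: numeral_2_eq_2 field_simps)

lemma real_Suc_choose_3: "real ((r + 1) choose 3) = (real r + 1) * real r * (real r - 1) / 6"
proof (induction r)
  case (Suc r)
  have "(Suc r + 1) choose 3 = ((r + 1) choose 2) + ((r + 1) choose 3)"
    by (simp add: eval_nat_numeral)
  then show ?case
    using Suc real_choose_2[of "r + 1"] by (simp add: field_simps)
qed simp

text \<open>
  All entries of the determinant are in the range of \<open>moment_eval\<close>; their separate
  dependence on the row and on the column is pulled out, and \<open>det_qpoch_quotient\<close> is used
  with \<open>c = q\<^sup>1\<^sup>/\<^sup>2\<close> and \<open>d = 0\<close>. There \<open>p - q\<^sup>u\<^sup>+\<^sup>1 = p (1 - p q\<^sup>u)\<close>, so the products over \<open>u\<close> are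
  q-factorials with base \<open>p\<close>.
\<close>

lemma lhs_sum_nondegenerate:
  assumes q: "0 < q" "q < 1" and a: "2 * n = real a" and b: "2 * m = real b" and N: "m + n = real N"
    and r: "real r - 1 \<le> n" "real r - 1 \<le> m"
  defines "p \<equiv> q powr (1/2)"
  shows "lhs_sum q r m n = fact r * (2 / (1 + q)) ^ r * (1 - q) powr (- 2 * (real r * (real r - 1)))
    * q powr (- 2 * real ((r + 1) choose 3) + 1 / 2 * real (r choose 2))
    * (\<Prod>t<r. qpoch q q a * qpoch q q b * qpoch p p (2 * t) * qpoch p q (N + 1 - t - r)
         / (qpoch q q (N - t) * qpoch p p (a - 2 * t) * qpoch p p (b - 2 * t)))"
proof -
  have p: "p\<^sup>2 = q" "0 < p" "p < 1"
    using q by (auto simp: p_def powr_power powr_half_sqrt)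
  have pos: "qpoch q q k > 0" "qpoch p q k > 0" "qpoch p p k > 0" for k
    using q p by (simp_all add: qpoch_pos)
  have ra: "2 * r \<le> a + 2" and rb: "2 * r \<le> b + 2" and rN: "2 * r \<le> N + 2"
    using r a b N by linarith+
  have n: "2 * n \<in> \<nat>" "2 * m \<in> \<nat>" "m + n \<in> \<int>" using a b N by simp_all
  have "moment q n (n - real i) (m - real j) (1/2)
      = 1 / qpoch p p (a - 2 * i) * (1 / qpoch p p (b - 2 * j)) * (qpoch p q (N - i - j) / qpoch q q (N + 0 - i - j))"
    if ij: "i < r" "j < r" for i j
  proof -
    have "n - real i + (m - real j) = real (N - i - j)" "2 * (n - real i) = real (a - 2 * i)"
      "2 * (m - real j) = real (b - 2 * j)"
      using a b N ij ra rb rN by (simp_all add: of_nat_diff)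
    then have f: "nat \<lfloor>n - real i + (m - real j)\<rfloor> = N - i - j" "nat \<lfloor>2 * (n - real i)\<rfloor> = a - 2 * i"
      "nat \<lfloor>2 * (m - real j)\<rfloor> = b - 2 * j"
      by (auto intro!: nat_floor_eqI)
    have "n - real i + n = real a - real i" "m - real j + n = real N - real j"
      using a N by simp_all
    then have "n - real i + n \<in> \<int>" "m - real j + n \<in> \<int>"
      by (simp_all only: Ints_diff Ints_of_nat)
    moreover have "n - real i \<ge> 0" "m - real j \<ge> 0" using r ij by auto
    ultimately have "moment q n (n - real i) (m - real j) (1/2)
      * (qpoch q q (N - i - j) * qpoch p p (a - 2 * i) * qpoch p p (b - 2 * j)) = qpoch p q (N - i - j)"
      using moment_eval[OF q n(1), of "n - real i" "m - real j"] unfolding f p_def by simp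
    then show ?thesis
      using pos(1)[of "N - i - j"] pos(3)[of "a - 2 * i"] pos(3)[of "b - 2 * j"]
      by (simp add: field_simps)
  qed
  then have D: "Determinant.det (mat r r (\<lambda>(i, j). moment q n (n - real i) (m - real j) (1/2)))
    = Determinant.det (mat r r (\<lambda>(i, j). 1 / qpoch p p (a - 2 * i) * (1 / qpoch p p (b - 2 * j))
         * (qpoch p q (N - i - j) / qpoch q q (N + 0 - i - j))))"
    by (intro arg_cong[where f = Determinant.det] cong_mat) auto
  have pq: "p * q ^ k \<noteq> 1" for k
  proof -
    have "p * q ^ k \<le> p * 1" using p q by (intro mult_left_mono power_le_one) auto
    then have "p * q ^ k < 1" using p by linarith
    then show ?thesis by simp
  qed
  have c: "qpoch q q t * (\<Prod>u<t. p - q ^ (0 + u + 1)) = p powr (0 + 1 * real t) * qpoch p p (2 * t)" for t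
  proof -
    have "p - q ^ (0 + u + 1) = p * (1 - p * q ^ u)" for u
      using p(1) by (simp add: power2_eq_square algebra_simps)
    then have "(\<Prod>u<t. p - q ^ (0 + u + 1)) = p ^ t * qpoch p q t"
      by (simp add: prod.distrib qpoch_lessThan)
    then show ?thesis
      using p by (simp add: qpoch_sqrt_double[OF p(1)] powr_realpow)
  qed
  have d: "(\<Prod>j<r. \<Prod>l<j. (1 - q) ^ 4 * q powr (m + n - 2 * real l))
     = (1 - q) powr (2 * (real r * (real r - 1)))
       * q powr (real N * (real r * (real r - 1) / 2) - real r * (real r - 1) * (real r - 2) / 3)"
  proof -
    have "(\<Prod>l<j. (1 - q) ^ 4 * q powr (m + n - 2 * real l))
      = (1 - q) powr (0 + 4 * real j) * q powr (real N * real j + (-1) * (real j * (real j - 1)))" for j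
    proof -
      have "(\<Prod>l<j. q powr (m + n - 2 * real l)) = q powr (real N * real j + (-1) * (real j * (real j - 1)))"
        using prod_powr_linear[OF q(1), where \<alpha> = "real N" and \<beta> = "-2" and r = j] by (simp add: N)
      moreover have "((1 - q) ^ 4) ^ j = (1 - q) powr (0 + 4 * real j)"
        using q powr_realpow[of "1 - q" "4 * j"] by (simp add: power_mult)
      ultimately show ?thesis by (simp add: prod.distrib)
    qed
    then show ?thesis
      using q by (simp only: prod.distrib prod_powr_linear prod_powr_quadratic) simp
  qed
  have P: "p powr x = q powr (x / 2)" for x by (simp add: p_def powr_powr)
  have nf: "nat \<lfloor>2 * n\<rfloor> = a" "nat \<lfloor>2 * m\<rfloor> = b" using a b by (auto intro: nat_floor_eqI)
  let ?e1 = "real N * (real r * (real r - 1) / 2) - real r * (real r - 1) * (2 * real r - 1) / 3"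
  let ?e2 = "real N * (real r * (real r - 1) / 2) - real r * (real r - 1) * (real r - 2) / 3"
  let ?e3 = "(0 * real r + 1 * (real r * (real r - 1) / 2)) / 2"
  have V: "Determinant.det (mat r r (\<lambda>(i, j). qpoch p q (N - i - j) / qpoch q q (N + 0 - i - j)))
     = q powr ?e1 * ((\<Prod>t<r. qpoch p q (N + 1 - t - r) / qpoch q q (N + 0 - t))
        * (q powr ?e3 * (\<Prod>t<r. qpoch p p (2 * t))))"
    unfolding det_qpoch_quotient[OF q rN pq, of 0]
    by (simp only: mult.assoc c) (simp only: prod.distrib prod_powr_linear[OF p(2)], simp only: P)
  have L: "lhs_sum q r m n = fact r / ((1 - q) powr (2 * (real r * (real r - 1))) * q powr ?e2)
     * (2 * qpoch q q a * qpoch q q b / (1 + q)) ^ r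
     * ((\<Prod>t<r. 1 / qpoch p p (a - 2 * t)) * (\<Prod>t<r. 1 / qpoch p p (b - 2 * t))
     * (q powr ?e1 * ((\<Prod>t<r. qpoch p q (N + 1 - t - r) / qpoch q q (N + 0 - t))
        * (q powr ?e3 * (\<Prod>t<r. qpoch p p (2 * t))))))"
    unfolding lhs_sum_eq_det[OF q n] D det_scale_rows_cols V d nf ..
  have "q powr ?e1 * q powr ?e3 / q powr ?e2 = q powr (?e1 + ?e3 - ?e2)"
    by (simp add: powr_add powr_diff)
  also have "?e1 + ?e3 - ?e2 = - 2 * real ((r + 1) choose 3) + 1 / 2 * real (r choose 2)"
    unfolding real_choose_2 real_Suc_choose_3 by (simp add: field_simps)
  finally have E: "q powr (- 2 * real ((r + 1) choose 3) + 1 / 2 * real (r choose 2))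
     = q powr ?e1 * q powr ?e3 / q powr ?e2" by simp
  have M: "(1 - q) powr (- 2 * (real r * (real r - 1))) = 1 / (1 - q) powr (2 * (real r * (real r - 1)))"
    using powr_minus_divide[of "1 - q" "2 * (real r * (real r - 1))"] by simp
  have B: "(2 * qpoch q q a * qpoch q q b / (1 + q)) ^ r
     = (2 / (1 + q)) ^ r * ((\<Prod>t<r. qpoch q q a) * (\<Prod>t<r. qpoch q q b))"
    by (simp add: power_mult_distrib power_divide)
  show ?thesis
    unfolding L E M B by (simp add: prod.distrib prod_dividef power_mult_distrib mult_ac)
qed

text \<open>
  Every q-Gamma value is a q-factorial times a power of \<open>1 - q\<close> or \<open>1 - p\<close>. The exponents of
  \<open>1 - p\<close> sum to zero over the product, and those of \<open>1 - q\<close> to \<open>- 2 r (r - 1)\<close>, the power that the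
  brackets contribute on the other side.
\<close>

lemma rhs_product_nondegenerate:
  assumes q: "0 < q" "q < 1" and a: "2 * n = real a" and b: "2 * m = real b" and N: "m + n = real N"
    and r: "real r - 1 \<le> n" "real r - 1 \<le> m"
  defines "p \<equiv> q powr (1/2)"
  shows "rhs_product q r m n = fact r * (2 / (1 + q)) ^ r * (1 - q) powr (- 2 * (real r * (real r - 1)))
    * q powr (- 2 * real ((r + 1) choose 3) + 1 / 2 * real (r choose 2))
    * (\<Prod>t<r. qpoch q q a * qpoch q q b * qpoch p p (2 * t) * qpoch p q (N + 1 - t - r)
         / (qpoch q q (N - t) * qpoch p p (a - 2 * t) * qpoch p p (b - 2 * t)))"
proof -
  have p: "p\<^sup>2 = q" "0 < p" "p < 1"
    using q by (auto simp: p_def powr_power powr_half_sqrt)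
  have pos: "qpoch q q k > 0" "qpoch p q k > 0" "qpoch p p k > 0" for k
    using q p by (simp_all add: qpoch_pos)
  have ra: "2 * r \<le> a + 2" and rb: "2 * r \<le> b + 2" and rN: "2 * r \<le> N + 2"
    using r a b N by linarith+
  let ?F = "\<lambda>i. (qGamma p (2 * real i - 1)
             * qGamma q (2 * n + 1) * qGamma q (2 * m + 1))
          / (qGamma q (m + n - real i + 2) * qGamma q (m + n - real i - real r + 3))
          * (qGamma p (2 * m + 2 * n - 2 * real i - 2 * real r + 5)
             / (qGamma p (2 * n - 2 * real i + 3)
                * qGamma p (2 * m - 2 * real i + 3)))"
  let ?core = "\<lambda>t. qpoch q q a * qpoch q q b * qpoch p p (2 * t) * qpoch p q (N + 1 - t - r)
         / (qpoch q q (N - t) * qpoch p p (a - 2 * t) * qpoch p p (b - 2 * t))"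
  have F: "?F (Suc t) = ?core t * (1 - q) powr ((1 - real r) + (-2) * real t)
      * (1 - p) powr ((2 * real r - 2) + (-4) * real t)"
    if t: "t < r" for t
  proof -
    define M where "M = N + 1 - t - r"
    have M: "real M = real N + 1 - real t - real r" using t rN by (simp add: M_def of_nat_diff)
    have x: "2 * real (Suc t) - 1 = real (2 * t) + 1" "2 * n + 1 = real a + 1" "2 * m + 1 = real b + 1"
      "m + n - real (Suc t) + 2 = real (N - t) + 1"
      "m + n - real (Suc t) - real r + 3 = real M + 1"
      "2 * m + 2 * n - 2 * real (Suc t) - 2 * real r + 5 = real (2 * M) + 1"
      "2 * n - 2 * real (Suc t) + 3 = real (a - 2 * t) + 1"
      "2 * m - 2 * real (Suc t) + 3 = real (b - 2 * t) + 1"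
      using a b N M t ra rb rN by (simp_all add: of_nat_diff)
    have "real a + real b = 2 * real N" "real (N - t) = real N - real t"
      "real (a - 2 * t) = real a - 2 * real t" "real (b - 2 * t) = real b - 2 * real t"
      using a b N t ra rb rN by (simp_all add: of_nat_diff)
    then have "(1 - real r) + (-2) * real t = - real a + - real b - (- real (N - t) + - real M)"
      "(2 * real r - 2) + (-4) * real t
        = - real (2 * t) + - real (2 * M) - (- real (a - 2 * t) + - real (b - 2 * t))"
      using M by simp_all
    then have e: "(1 - q) powr ((1 - real r) + (-2) * real t)
       = (1 - q) powr (- real a) * (1 - q) powr (- real b)
           / ((1 - q) powr (- real (N - t)) * (1 - q) powr (- real M))"
      "(1 - p) powr ((2 * real r - 2) + (-4) * real t)
       = (1 - p) powr (- real (2 * t)) * (1 - p) powr (- real (2 * M))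
           / ((1 - p) powr (- real (a - 2 * t)) * (1 - p) powr (- real (b - 2 * t)))"
      by (simp_all only: powr_add powr_diff)
    have alg: "((pt * Pt) * (qa * Qa) * (qb * Qb)) / ((qN * QN) * (qM * QM)) * ((pM * (PM * QM)) / ((pa * Pa) * (pb * Pb)))
       = Qa * Qb * Pt * PM / (QN * Pa * Pb) * (qa * qb / (qN * qM)) * (pt * pM / (pa * pb))"
      if "QM \<noteq> 0"
      for pt Pt qa Qa qb Qb qN QN qM QM pM PM pa Pa pb Pb :: real
      using that by (simp add: mult_ac)
    have "qpoch q q M \<noteq> 0" using pos(1)[of M] by simp
    then show ?thesis
      unfolding x qGamma_Suc_of_nat[OF q refl] qGamma_Suc_of_nat[OF p(2,3) refl] e M_def[symmetric]
        qpoch_sqrt_double[OF p(1), of M]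
      by (rule alg)
  qed
  have "(\<Prod>i = 1..r. ?F i) = (\<Prod>t<r. ?F (Suc t))"
    by (simp only: One_nat_def prod.atLeast1_atMost_eq)
  also have "\<dots> = (\<Prod>t<r. ?core t * (1 - q) powr ((1 - real r) + (-2) * real t)
      * (1 - p) powr ((2 * real r - 2) + (-4) * real t))"
    using F by (intro prod.cong) auto
  also have "\<dots> = (\<Prod>t<r. ?core t) * (1 - q) powr (- 2 * (real r * (real r - 1)))"
  proof -
    have "(1 - real r) * real r + (-2) * (real r * (real r - 1) / 2) = - 2 * (real r * (real r - 1))"
      "(2 * real r - 2) * real r + (-4) * (real r * (real r - 1) / 2) = 0"
      by (simp_all add: field_simps)
    then show ?thesis
      using q p by (simp only: prod.distrib prod_powr_linear diff_gt_0_iff_gt) simp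
  qed
  finally have prod: "(\<Prod>i = 1..r. ?F i) = (\<Prod>t<r. ?core t) * (1 - q) powr (- 2 * (real r * (real r - 1)))" .
  have "2 / qbracket q 2 = 2 / (1 + q)"
  proof -
    have "1 - q powr 2 = (1 + q) * (1 - q)" using q by (simp add: powr_numeral power2_eq_square algebra_simps)
    then show ?thesis using q by (simp add: qbracket_def)
  qed
  then show ?thesis
    unfolding rhs_product_def p_def[symmetric] prod by (simp only: mult_ac)
qed

lemma no_numerator_pole:
  assumes "m \<ge> 0" "n \<ge> 0" "real r - 1 \<le> n" "real r - 1 \<le> m"
  shows "\<not> rhs_numerator_pole r m n"
proof
  assume "rhs_numerator_pole r m n"
  then obtain i x where i: "i \<in> {1..r}" and x: "x \<in> {2 * real i - 1, 2 * n + 1, 2 * m + 1,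
      2 * m + 2 * n - 2 * real i - 2 * real r + 5}" "x \<in> \<int>\<^sub>\<le>\<^sub>0"
    unfolding rhs_numerator_pole_def by blast
  have "x > 0" using x(1) i assms by auto
  moreover have "x \<le> 0" using x(2) by (auto elim: nonpos_Ints_cases)
  ultimately show False by simp
qed

section \<open>The multiple sum in closed form\<close>

theorem proposition6p2:
  fixes q m n :: real and r :: nat
  assumes "0 < q" and "q < 1" and "r \<ge> 1"
    and "(m \<in> \<nat> \<and> n \<in> \<nat>) \<or>
         (half_integer m \<and> m > 0 \<and> half_integer n \<and> n > 0)"
  shows "if rhs_numerator_pole r m n
         then ((\<lambda>\<epsilon>. rhs_product q r (m + \<epsilon>) (n + \<epsilon>)) \<longlongrightarrow> lhs_sum q r m n) (at 0)
         else lhs_sum q r m n = rhs_product q r m n"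
proof -
  \<comment> \<open>in both cases \<open>2 n\<close>, \<open>2 m\<close> and \<open>m + n\<close> are natural numbers\<close>
  obtain a b N where a: "2 * n = real a" and b: "2 * m = real b" and N: "m + n = real N"
    using assms(4)
  proof
    assume "m \<in> \<nat> \<and> n \<in> \<nat>"
    then obtain m' n' where "m = real m'" "n = real n'" by (auto elim!: Nats_cases)
    then show thesis using that[of "2 * n'" "2 * m'" "m' + n'"] by simp
  next
    assume h: "half_integer m \<and> m > 0 \<and> half_integer n \<and> n > 0"
    then obtain i j where ij: "m - 1/2 = of_int i" "n - 1/2 = of_int j"
      unfolding half_integer_def by (auto elim!: Ints_cases)
    then have "i \<ge> 0" "j \<ge> 0" using h by linarith+
    then have "m = real (nat i) + 1/2" "n = real (nat j) + 1/2" using ij by simp_all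
    then show thesis using that[of "2 * nat j + 1" "2 * nat i + 1" "nat i + nat j + 1"] by simp
  qed
  have nat: "2 * n \<in> \<nat>" "2 * m \<in> \<nat>" "m + n \<in> \<int>" using a b N by simp_all
  have nn: "n \<ge> 0" "m \<ge> 0" using a b by linarith+
  show ?thesis
  proof (cases "n < real r - 1 \<or> m < real r - 1")
    case True
    note deg = assms(3) True
    show ?thesis
      using lhs_sum_degenerate[OF assms(1,2) nat deg] rhs_product_degenerate[OF assms(1,2) nat(1,2) deg]
        rhs_product_degenerate_tendsto[OF assms(1,2) nat deg] by simp
  next
    case False
    then have r: "real r - 1 \<le> n" "real r - 1 \<le> m" by simp_all
    show ?thesis
      using no_numerator_pole[OF nn(2,1) r] lhs_sum_nondegenerate[OF assms(1,2) a b N r]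
        rhs_product_nondegenerate[OF assms(1,2) a b N r] by simp
  qed
qed

end
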